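(* Under the standing assumptions of the context, let $0\le i\le T-1$. Assume $C_G(P_i)\le P_i$ and that every automorphism of $G$ induced by a derivation in $\mathrm{Der}(G/P_i,\Omega_1(Z(P_i)))$ is inner. Then there exists an automorphism $\phi$ of $G$ of order $p$ such that $\phi$ fixes $P_{i+1}$ elementwise but does not fix $P_i$ elementwise.
   Context: Standing assumptions: $p$ is an odd prime; $G$ is a finite non-abelian $p$-group with cyclic center; $\Omega_1(Z(G))\le\gamma_3(G)G^p$ and $|\Phi(G)/\gamma_3(G)G^p|=p^T\ge p$. Fix normal subgroups $\gamma_3(G)G^p=P_T\le P_{T-1}\le\cdots\le P_1\le P_0=\Phi(G)$ with $|P_i/P_{i+1}|=p$. Here $\Omega_1(X)=\langle x:x^p=1\rangle$, $G^p=\langle g^p\rangle$. $G/P_i$ acts on $\Omega_1(Z(P_i))$ by conjugation; $\mathrm{Der}(G/P_i,\Omega_1(Z(P_i)))$ is the set of maps $\delta:G\to\Omega_1(Z(P_i))$ with $\delta(xy)=\delta(x)^y\delta(y)$ and $\delta(P_i)=1$; the automorphism induced by such $\delta$ is $g\mapsto g\delta(g)$. *)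

theory Defs
  imports "HOL-Algebra.Algebra"
begin

definition center_of :: "('a, 'b) monoid_scheme \<Rightarrow> 'a set \<Rightarrow> 'a set" where
  "center_of G H = {z \<in> H. \<forall>h \<in> H. z \<otimes>\<^bsub>G\<^esub> h = h \<otimes>\<^bsub>G\<^esub> z}"

definition centralizer :: "('a, 'b) monoid_scheme \<Rightarrow> 'a set \<Rightarrow> 'a set" where
  "centralizer G H = {g \<in> carrier G. \<forall>h \<in> H. g \<otimes>\<^bsub>G\<^esub> h = h \<otimes>\<^bsub>G\<^esub> g}"

definition Omega1 :: "('a, 'b) monoid_scheme \<Rightarrow> nat \<Rightarrow> 'a set \<Rightarrow> 'a set" where
  "Omega1 G p S = generate G {x \<in> S. x [^]\<^bsub>G\<^esub> p = \<one>\<^bsub>G\<^esub>}"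

definition power_subgroup :: "('a, 'b) monoid_scheme \<Rightarrow> nat \<Rightarrow> 'a set" where
  "power_subgroup G p = generate G {g [^]\<^bsub>G\<^esub> p | g. g \<in> carrier G}"

definition commutator_subgroup :: "('a, 'b) monoid_scheme \<Rightarrow> 'a set \<Rightarrow> 'a set \<Rightarrow> 'a set" where
  "commutator_subgroup G A B = generate G
     {a \<otimes>\<^bsub>G\<^esub> b \<otimes>\<^bsub>G\<^esub> inv\<^bsub>G\<^esub> a \<otimes>\<^bsub>G\<^esub> inv\<^bsub>G\<^esub> b | a b. a \<in> A \<and> b \<in> B}"

definition gamma3 :: "('a, 'b) monoid_scheme \<Rightarrow> 'a set" where
  "gamma3 G = commutator_subgroup G
     (commutator_subgroup G (carrier G) (carrier G)) (carrier G)"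

definition subgroup_prod :: "('a, 'b) monoid_scheme \<Rightarrow> 'a set \<Rightarrow> 'a set \<Rightarrow> 'a set" where
  "subgroup_prod G H K = generate G (H \<union> K)"

definition maximal_subgroup :: "('a, 'b) monoid_scheme \<Rightarrow> 'a set \<Rightarrow> bool" where
  "maximal_subgroup G M \<longleftrightarrow> subgroup M G \<and> M \<noteq> carrier G \<and>
     (\<forall>H. subgroup H G \<and> M \<subseteq> H \<longrightarrow> H = M \<or> H = carrier G)"

text \<open>Frattini subgroup: intersection of all maximal subgroups (= G if there are none).\<close>
definition frattini :: "('a, 'b) monoid_scheme \<Rightarrow> 'a set" where
  "frattini G = carrier G \<inter> \<Inter>{M. maximal_subgroup G M}"

definition p_group :: "('a, 'b) monoid_scheme \<Rightarrow> nat \<Rightarrow> bool" where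
  "p_group G p \<longleftrightarrow> group G \<and> finite (carrier G) \<and> (\<exists>n. card (carrier G) = p ^ n)"

text \<open>Der(G/P, A): maps delta : G -> A with delta(xy) = delta(x)^y delta(y),
  where a^y = y^{-1} a y, and delta(P) = 1.\<close>
definition derivations :: "('a, 'b) monoid_scheme \<Rightarrow> 'a set \<Rightarrow> 'a set \<Rightarrow> ('a \<Rightarrow> 'a) set" where
  "derivations G P A = {\<delta>. \<delta> \<in> carrier G \<rightarrow> A \<and>
     (\<forall>x \<in> carrier G. \<forall>y \<in> carrier G.
        \<delta> (x \<otimes>\<^bsub>G\<^esub> y) = (inv\<^bsub>G\<^esub> y \<otimes>\<^bsub>G\<^esub> \<delta> x \<otimes>\<^bsub>G\<^esub> y) \<otimes>\<^bsub>G\<^esub> \<delta> y) \<and>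
     (\<forall>x \<in> P. \<delta> x = \<one>\<^bsub>G\<^esub>)}"

definition inner_automorphism :: "('a, 'b) monoid_scheme \<Rightarrow> ('a \<Rightarrow> 'a) \<Rightarrow> bool" where
  "inner_automorphism G \<phi> \<longleftrightarrow>
     (\<exists>h \<in> carrier G. \<forall>g \<in> carrier G. \<phi> g = h \<otimes>\<^bsub>G\<^esub> g \<otimes>\<^bsub>G\<^esub> inv\<^bsub>G\<^esub> h)"

end

theory Submission
  imports Defs "HOL-Number_Theory.Cong"
begin

text \<open>
  Write $F = P_0 = \Phi(G)$, $N = P_i$, $L = P_{i+1}$, and let \<open>z\<close> generate
  $\Omega_1(Z(G))$. A homomorphism \<open>f\<close> from \<open>G\<close> to the integers modulo \<open>p\<close> gives the derivation
  \<open>g \<mapsto> z [^] f g\<close>, so by hypothesis there is an $h \in Z(N)$ with $[h, g] = z^{f(g)}$. Since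
  $h^p$ lies in the cyclic group $Z(G)$, those \<open>f\<close> for which \<open>h\<close> can be taken of exponent \<open>p\<close> form a
  subspace of codimension at most one. Hence, with
  $W = \{w \in \Omega_1(Z(N)) : [w, G] \subseteq \langle z\rangle\}$ and $E = C_G(W)$, the quotient
  $EF/F$ is cyclic, and every \<open>f\<close> that vanishes on \<open>E\<close> is induced by an element of \<open>W\<close>.

  Choose a functional \<open>\<mu>\<close> on \<open>F\<close> that kills \<open>L\<close> but not \<open>N\<close>. Then $c(x, y) = \mu([x, y])$ is an
  alternating form modulo \<open>p\<close>; since $EF/F$ is cyclic and \<open>p\<close> is odd, $c(x, y) = B(x, y) - B(y, x)$
  for a bilinear \<open>B\<close> that vanishes whenever its second argument lies in \<open>E\<close>. So every $B(g, \cdot)$ is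
  induced by elements of \<open>W\<close>, and the pairs \<open>(g, w)\<close> with \<open>w\<close> inducing $B(g, \cdot)$ form a
  central extension of \<open>G\<close> by $\langle z\rangle$. It contains the graph of
  $u \mapsto z^{\mu(u)}$ on \<open>F\<close>, and by the choice of \<open>B\<close> this graph contains all commutators and
  \<open>p\<close>-th powers; hence it extends to a complement of $\langle z\rangle$, which is the graph of a
  derivation \<open>\<delta>\<close> of \<open>G\<close> with values in \<open>W\<close>. The automorphism is \<open>g \<mapsto> g \<otimes> \<delta> g\<close>.
\<close>

section \<open>Homomorphisms modulo a prime\<close>

text \<open>Integer representatives stand for values modulo \<open>p\<close>, so that they can serve
  directly as exponents of an element of order \<open>p\<close>; statements about these values are
  therefore congruences.\<close>

definition hom_mod :: "('a, 'b) monoid_scheme \<Rightarrow> nat \<Rightarrow> ('a \<Rightarrow> int) \<Rightarrow> bool" where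
  "hom_mod G p f \<longleftrightarrow>
     (\<forall>x \<in> carrier G. \<forall>y \<in> carrier G. [f (x \<otimes>\<^bsub>G\<^esub> y) = f x + f y] (mod int p))"

lemma cong_inverse_prime:
  assumes "Factorial_Ring.prime (p::nat)" "\<not> int p dvd k"
  obtains l where "[k * l = 1] (mod int p)"
proof -
  have "Factorial_Ring.prime (int p)" using assms(1) by simp
  then have "coprime k (int p)" using assms(2) by (metis coprime_commute prime_imp_coprime)
  then show ?thesis using cong_solve_coprime_int that by blast
qed

lemma hom_modD:
  "hom_mod G p f \<Longrightarrow> x \<in> carrier G \<Longrightarrow> y \<in> carrier G \<Longrightarrow>
     [f (x \<otimes>\<^bsub>G\<^esub> y) = f x + f y] (mod int p)"
  by (simp add: hom_mod_def)

lemma hom_mod_lin: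
  assumes "hom_mod G p f" "hom_mod G p g"
  shows "hom_mod G p (\<lambda>x. a * f x + b * g x)"
  unfolding hom_mod_def
proof (intro ballI)
  fix x y assume xy: "x \<in> carrier G" "y \<in> carrier G"
  have "[a * f (x \<otimes>\<^bsub>G\<^esub> y) + b * g (x \<otimes>\<^bsub>G\<^esub> y) = a * (f x + f y) + b * (g x + g y)] (mod int p)"
    by (rule cong_add[OF cong_mult[OF cong_refl hom_modD[OF assms(1) xy]]
          cong_mult[OF cong_refl hom_modD[OF assms(2) xy]]])
  then show "[a * f (x \<otimes>\<^bsub>G\<^esub> y) + b * g (x \<otimes>\<^bsub>G\<^esub> y) = a * f x + b * g x + (a * f y + b * g y)] (mod int p)"
    by (simp add: algebra_simps)
qed

context group
begin

lemma hom_mod_one: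
  assumes "hom_mod G p f"
  shows "[f \<one> = 0] (mod int p)"
proof -
  have "[f (\<one> \<otimes> \<one>) = f \<one> + f \<one>] (mod int p)"
    using hom_modD[OF assms] by blast
  then show ?thesis by (simp add: cong_iff_dvd_diff)
qed

lemma hom_mod_inv:
  assumes "hom_mod G p f" "x \<in> carrier G"
  shows "[f (inv x) = - f x] (mod int p)"
proof -
  have "[f (x \<otimes> inv x) = f x + f (inv x)] (mod int p)"
    by (rule hom_modD[OF assms(1)]) (use assms in auto)
  then have "[0 = f x + f (inv x)] (mod int p)"
    using assms hom_mod_one[OF assms(1)] by (metis cong_trans cong_sym r_inv)
  from cong_add[OF cong_refl[of "- f x"] this] show ?thesis
    by (simp add: cong_sym)
qed

lemma hom_mod_nat_pow:
  assumes "hom_mod G p f" "x \<in> carrier G"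
  shows "[f (x [^] (n::nat)) = int n * f x] (mod int p)"
proof (induction n)
  case 0
  then show ?case using hom_mod_one[OF assms(1)] by simp
next
  case (Suc n)
  have "[f (x [^] n \<otimes> x) = f (x [^] n) + f x] (mod int p)"
    by (rule hom_modD[OF assms(1)]) (use assms in auto)
  also have "[f (x [^] n) + f x = int n * f x + f x] (mod int p)"
    by (rule cong_add[OF Suc cong_refl])
  finally show ?case by (simp add: algebra_simps)
qed

lemma hom_mod_int_pow:
  assumes "hom_mod G p f" "x \<in> carrier G"
  shows "[f (x [^] (k::int)) = k * f x] (mod int p)"
proof (cases k)
  case (nonneg n)
  then show ?thesis using hom_mod_nat_pow[OF assms, of n] by (simp only: int_pow_int)
next
  case (neg n)
  have "x [^] k = inv (x [^] Suc n)"
    unfolding neg(1) using assms(2) by (rule int_pow_neg_int)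
  then have "[f (x [^] k) = - f (x [^] Suc n)] (mod int p)"
    using hom_mod_inv[OF assms(1), of "x [^] Suc n"] assms(2) by simp
  also have "[- f (x [^] Suc n) = - (int (Suc n) * f x)] (mod int p)"
    using hom_mod_nat_pow[OF assms, of "Suc n"] by (simp only: cong_minus_minus_iff)
  finally show ?thesis unfolding neg(1) by (simp add: algebra_simps)
qed

lemma hom_mod_kernel:
  assumes "hom_mod G p f"
  shows "subgroup {x \<in> carrier G. [f x = 0] (mod int p)} G"
proof (rule subgroupI)
  show "{x \<in> carrier G. [f x = 0] (mod int p)} \<noteq> {}"
    using hom_mod_one[OF assms] by auto
next
  fix a assume "a \<in> {x \<in> carrier G. [f x = 0] (mod int p)}"
  then show "inv a \<in> {x \<in> carrier G. [f x = 0] (mod int p)}"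
    using hom_mod_inv[OF assms, of a] cong_minus_minus_iff[of "f a" 0 "int p"] by (auto intro: cong_trans)
next
  fix a b assume "a \<in> {x \<in> carrier G. [f x = 0] (mod int p)}"
    "b \<in> {x \<in> carrier G. [f x = 0] (mod int p)}"
  then show "a \<otimes> b \<in> {x \<in> carrier G. [f x = 0] (mod int p)}"
    using hom_modD[OF assms, of a b] cong_add[of "f a" 0 "int p" "f b" 0] by (auto intro: cong_trans)
qed auto

section \<open>Maximal subgroups avoiding an element, and separating functionals\<close>

lemma subgroup_adjoin:
  assumes M: "subgroup M G" and y: "y \<in> carrier G"
    and norm: "\<And>m k. m \<in> M \<Longrightarrow> y [^] (k::int) \<otimes> m \<otimes> inv (y [^] k) \<in> M"
  shows "subgroup {m \<otimes> y [^] (k::int) | m k. m \<in> M} G"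
    and "M \<subseteq> {m \<otimes> y [^] (k::int) | m k. m \<in> M}"
    and "y \<in> {m \<otimes> y [^] (k::int) | m k. m \<in> M}"
proof -
  let ?S = "{m \<otimes> y [^] (k::int) | m k. m \<in> M}"
  have Mc: "m \<in> carrier G" if "m \<in> M" for m using M that by (meson subgroup.mem_carrier)
  have 1: "\<one> \<in> M" using M by (rule subgroup.one_closed)
  show "M \<subseteq> ?S"
  proof
    fix m assume "m \<in> M"
    then have "m = m \<otimes> y [^] (0::int)" using Mc by simp
    then show "m \<in> ?S" using \<open>m \<in> M\<close> by blast
  qed
  have "y = \<one> \<otimes> y [^] (1::int)" using y by simp
  then show "y \<in> ?S" using 1 by blast
  show "subgroup ?S G"
  proof (rule subgroupI)
    show "?S \<subseteq> carrier G" using Mc y by auto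
    show "?S \<noteq> {}" using 1 by blast
  next
    fix a assume "a \<in> ?S"
    then obtain m k where mk: "m \<in> M" "a = m \<otimes> y [^] (k::int)" by blast
    have "inv a = (y [^] (-k) \<otimes> inv m \<otimes> inv (y [^] (-k))) \<otimes> y [^] (-k)"
      using Mc mk y by (simp add: inv_mult_group int_pow_neg m_assoc)
    moreover have "y [^] (-k) \<otimes> inv m \<otimes> inv (y [^] (-k)) \<in> M"
      using norm M mk by (meson subgroup.m_inv_closed)
    ultimately show "inv a \<in> ?S" by blast
  next
    fix a b assume "a \<in> ?S" "b \<in> ?S"
    then obtain m k n l where mk: "m \<in> M" "a = m \<otimes> y [^] (k::int)" "n \<in> M" "b = n \<otimes> y [^] (l::int)"
      by blast
    have "a \<otimes> b = (m \<otimes> (y [^] k \<otimes> n \<otimes> inv (y [^] k))) \<otimes> y [^] (k + l)"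
      using Mc mk y by (simp add: int_pow_mult m_assoc) (simp add: m_assoc[symmetric])
    moreover have "m \<otimes> (y [^] k \<otimes> n \<otimes> inv (y [^] k)) \<in> M"
      using norm M mk by (meson subgroup.m_closed)
    ultimately show "a \<otimes> b \<in> ?S" by blast
  qed
qed

text \<open>The hypotheses on \<open>K\<close> say that G/K is elementary abelian, so a subgroup
  maximal among those that contain \<open>K\<close> and avoid \<open>x\<close> is a hyperplane
  complementary to the line of \<open>x\<close>. For \<open>y\<close> outside \<open>M\<close>,
  maximality puts \<open>x\<close> into the group generated by \<open>M\<close> and
  \<open>y\<close>; this is solved for \<open>y\<close> modulo \<open>M\<close>, the exponent of
  \<open>y\<close> being invertible modulo \<open>p\<close>.\<close>

lemma maximal_avoiding:
  assumes fin: "finite (carrier G)" and p: "Factorial_Ring.prime (p::nat)" and K: "subgroup K G"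
    and comm: "\<And>a b. a \<in> carrier G \<Longrightarrow> b \<in> carrier G \<Longrightarrow> \<exists>k \<in> K. a \<otimes> b = k \<otimes> (b \<otimes> a)"
    and pow: "\<And>a. a \<in> carrier G \<Longrightarrow> a [^] p \<in> K"
    and x: "x \<in> carrier G" "x \<notin> K"
  obtains M where "subgroup M G" "K \<subseteq> M" "x \<notin> M"
    "\<And>y. y \<in> carrier G \<Longrightarrow> \<exists>k::int. y \<otimes> x [^] k \<in> M"
proof -
  define \<M> where "\<M> = {M. subgroup M G \<and> K \<subseteq> M \<and> x \<notin> M}"
  have "\<M> \<subseteq> Pow (carrier G)" unfolding \<M>_def by (auto dest: subgroup.subset)
  then have "finite \<M>" using fin finite_subset by blast
  moreover have "K \<in> \<M>" using K x by (simp add: \<M>_def)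
  ultimately obtain M where M: "M \<in> \<M>" and max: "\<And>N. N \<in> \<M> \<Longrightarrow> M \<subseteq> N \<Longrightarrow> N = M"
    by (metis finite_has_maximal empty_iff)
  have sM: "subgroup M G" and KM: "K \<subseteq> M" and xM: "x \<notin> M" using M by (auto simp: \<M>_def)
  note Mc = subgroup.mem_carrier[OF sM]
  \<comment> \<open>Passing \<open>a\<close> across an element of \<open>M\<close> costs a
    commutator, which lies in \<open>K\<close> and so in \<open>M\<close>; hence \<open>M\<close> is
    normal.\<close>
  have swap: "\<exists>m' \<in> M. a \<otimes> m = m' \<otimes> a" if "a \<in> carrier G" "m \<in> M" for a m
  proof -
    obtain k where k: "k \<in> K" "a \<otimes> m = k \<otimes> (m \<otimes> a)" using comm \<open>a \<in> carrier G\<close> Mc[OF \<open>m \<in> M\<close>] by blast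
    then have "a \<otimes> m = (k \<otimes> m) \<otimes> a" using that Mc KM by (simp add: m_assoc subset_iff)
    then show ?thesis using k that KM subgroup.m_closed[OF sM] by blast
  qed
  have norm: "a \<otimes> m \<otimes> inv a \<in> M" if am: "a \<in> carrier G" "m \<in> M" for a m
  proof -
    obtain m' where m': "m' \<in> M" "a \<otimes> m = m' \<otimes> a" using swap[OF am] by blast
    have "m' \<otimes> a \<otimes> inv a = m'" using m' Mc am by (simp add: m_assoc)
    then show ?thesis using m' by simp
  qed
  have "\<exists>k::int. y \<otimes> x [^] k \<in> M" if y: "y \<in> carrier G" for y
  proof (cases "y \<in> M")
    case True
    then have "y \<otimes> x [^] (0::int) \<in> M" using y by simp
    then show ?thesis by blast
  next
    case False
    let ?S = "{m \<otimes> y [^] (k::int) | m k. m \<in> M}"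
    have S: "subgroup ?S G" "M \<subseteq> ?S" "y \<in> ?S"
      using subgroup_adjoin[OF sM y] norm y by auto
    have "x \<in> ?S"
    proof (rule ccontr)
      assume "x \<notin> ?S"
      then have "?S \<in> \<M>" using S KM by (auto simp: \<M>_def)
      then show False using max S False by blast
    qed
    then obtain m k where mk: "m \<in> M" "x = m \<otimes> y [^] (k::int)" by blast
    \<comment> \<open>Otherwise \<open>y [^] k\<close> is a power of \<open>y [^] p\<close> and lies
      in \<open>M\<close>, which would force \<open>x\<close> into \<open>M\<close>.\<close>
    have "\<not> int p dvd k"
    proof
      assume "int p dvd k"
      then obtain j where "k = int p * j" by blast
      then have "y [^] k = (y [^] p) [^] j" using y by (simp add: int_pow_pow int_pow_int[symmetric])
      then have "y [^] k \<in> M" using pow[OF y] KM sM by (simp add: subgroup_int_pow_closed subset_iff)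
      then show False using mk xM subgroup.m_closed[OF sM] by blast
    qed
    then obtain l where l: "[k * l = 1] (mod int p)" by (rule cong_inverse_prime[OF p])
    \<comment> \<open>A natural number inverse to \<open>k\<close> modulo \<open>p\<close>. Modulo
      \<open>M\<close>, \<open>x [^] n\<close> is then \<open>y\<close>, so \<open>- n\<close> is
      the wanted exponent.\<close>
    define n where "n = nat (l mod int p)"
    have n: "[k * int n = 1] (mod int p)"
      using l p by (simp add: n_def cong_def prime_gt_0_nat mod_mult_right_eq)
    have powS: "\<exists>m' \<in> M. x [^] (n::nat) = m' \<otimes> y [^] (k * int n)" for n
    proof (induction n)
      case 0
      then show ?case using subgroup.one_closed[OF sM] by (auto intro!: bexI[of _ "\<one>"])
    next
      case (Suc n)
      then obtain m' where m': "m' \<in> M" "x [^] n = m' \<otimes> y [^] (k * int n)" by blast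
      obtain m'' where m'': "m'' \<in> M" "y [^] (k * int n) \<otimes> m = m'' \<otimes> y [^] (k * int n)"
        using swap[of "y [^] (k * int n)" m] y mk by auto
      have "x [^] Suc n = m' \<otimes> (y [^] (k * int n) \<otimes> m) \<otimes> y [^] k"
        using m' mk y Mc by (simp add: m_assoc)
      also have "\<dots> = m' \<otimes> m'' \<otimes> (y [^] (k * int n) \<otimes> y [^] k)"
        using m'' m' mk y Mc by (simp add: m_assoc)
      also have "\<dots> = m' \<otimes> m'' \<otimes> y [^] (k * int (Suc n))"
        using y by (simp add: int_pow_mult[symmetric] algebra_simps)
      finally show ?case using m' m'' subgroup.m_closed[OF sM] by blast
    qed
    obtain m' where m': "m' \<in> M" "x [^] n = m' \<otimes> y [^] (k * int n)" using powS by blast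
    obtain q where q: "k * int n = 1 + int p * q"
      using n by (metis cong_iff_lin cong_sym)
    have yq: "y [^] (int p * q) \<in> M"
    proof -
      have "y [^] (int p * q) = (y [^] p) [^] q" using y by (simp add: int_pow_pow int_pow_int[symmetric])
      then show ?thesis using pow[OF y] KM sM by (simp add: subgroup_int_pow_closed subset_iff)
    qed
    have "x [^] n = m' \<otimes> (y \<otimes> y [^] (int p * q))"
      using m' q y by (simp add: int_pow_mult)
    obtain m2 where m2: "m2 \<in> M" "y \<otimes> y [^] (int p * q) = m2 \<otimes> y" using swap[OF y yq] by blast
    have xn: "x [^] n = m' \<otimes> m2 \<otimes> y"
      using \<open>x [^] n = m' \<otimes> (y \<otimes> y [^] (int p * q))\<close> m2 m' Mc y by (simp add: m_assoc)
    have "y \<otimes> x [^] (- int n) = y \<otimes> (inv y \<otimes> inv (m' \<otimes> m2))"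
      using xn m' m2 Mc y x by (simp add: int_pow_neg int_pow_int inv_mult_group m_assoc)
    also have "\<dots> = inv (m' \<otimes> m2)" using m' m2 Mc y by (simp add: m_assoc[symmetric])
    also have "\<dots> \<in> M" using m' m2 sM by (meson subgroup.m_closed subgroup.m_inv_closed)
    finally show ?thesis by blast
  qed
  then show ?thesis using that sM KM xM by blast
qed

text \<open>The quotient by the subgroup \<open>M\<close> of \<open>maximal_avoiding\<close> has
  order \<open>p\<close> and is generated by the image of \<open>x\<close>; \<open>f\<close> reads
  off the coordinate along \<open>x\<close>.\<close>

lemma hom_mod_separating:
  assumes fin: "finite (carrier G)" and p: "Factorial_Ring.prime (p::nat)" and K: "subgroup K G"
    and comm: "\<And>a b. a \<in> carrier G \<Longrightarrow> b \<in> carrier G \<Longrightarrow> \<exists>k \<in> K. a \<otimes> b = k \<otimes> (b \<otimes> a)"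
    and pow: "\<And>a. a \<in> carrier G \<Longrightarrow> a [^] p \<in> K"
    and x: "x \<in> carrier G" "x \<notin> K"
  obtains f where "hom_mod G p f" "\<And>k. k \<in> K \<Longrightarrow> [f k = 0] (mod int p)" "[f x = 1] (mod int p)"
proof -
  obtain M where M: "subgroup M G" and KM: "K \<subseteq> M" and xM: "x \<notin> M"
    and cov: "\<And>y. y \<in> carrier G \<Longrightarrow> \<exists>k::int. y \<otimes> x [^] k \<in> M"
    using maximal_avoiding[OF assms] by metis
  note Mc = subgroup.mem_carrier[OF M]
  have dvd: "int p dvd k" if k: "x [^] (k::int) \<in> M" for k
  proof (rule ccontr)
    assume "\<not> int p dvd k"
    then obtain l where "[k * l = 1] (mod int p)" by (rule cong_inverse_prime[OF p])
    then obtain q where q: "1 = k * l + int p * q" by (metis cong_iff_lin)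
    have "x = (x [^] k) [^] l \<otimes> (x [^] p) [^] q"
      using x q by (metis int_pow_1 int_pow_int int_pow_mult int_pow_pow)
    moreover have "x [^] p \<in> M" using pow x KM by blast
    ultimately have "x \<in> M"
      using k M by (metis subgroup.m_closed subgroup_int_pow_closed)
    then show False using xM by simp
  qed
  \<comment> \<open>The chosen exponent moves \<open>y\<close> into \<open>M\<close>, so it is minus
    the coordinate; hence the sign.\<close>
  define f where "f y = - (SOME k::int. y \<otimes> x [^] k \<in> M)" for y
  have f: "y \<otimes> x [^] (- f y) \<in> M" if "y \<in> carrier G" for y
    using someI_ex[OF cov[OF that]] by (simp add: f_def)
  have uniq: "[f y = k] (mod int p)" if "y \<in> carrier G" "y \<otimes> x [^] (- k) \<in> M" for y k
  proof -
    have "inv (y \<otimes> x [^] (- f y)) \<otimes> (y \<otimes> x [^] (- k)) = x [^] (f y) \<otimes> x [^] (-k)"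
      using that(1) x by (simp add: inv_mult_group int_pow_neg m_assoc) (simp add: m_assoc[symmetric])
    also have "\<dots> = x [^] (f y - k)" using x by (simp add: int_pow_mult[symmetric])
    finally have "x [^] (f y - k) \<in> M" using that f M by (metis subgroup.m_closed subgroup.m_inv_closed)
    then show ?thesis using dvd by (simp add: cong_iff_dvd_diff)
  qed
  have "hom_mod G p f"
    unfolding hom_mod_def
  proof (intro ballI uniq)
    \<comment> \<open>Reordering the product costs two commutators in \<open>K\<close>: one from
      moving the power of \<open>x\<close> past \<open>z\<close>, one from moving the first
      commutator past \<open>y\<close>.\<close>
    fix y z assume yz: "y \<in> carrier G" "z \<in> carrier G"
    let ?m = "y \<otimes> x [^] (- f y)" and ?n = "z \<otimes> x [^] (- f z)"
    obtain k where k: "k \<in> K" "z \<otimes> x [^] (- f y) = k \<otimes> (x [^] (- f y) \<otimes> z)"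
      using comm[of z "x [^] (- f y)"] yz x by auto
    obtain k' where k': "k' \<in> K" "y \<otimes> k = k' \<otimes> (k \<otimes> y)"
      using comm[of y k] yz k subgroup.mem_carrier[OF K] by auto
    have kc: "k \<in> carrier G" "k' \<in> carrier G" using k k' subgroup.mem_carrier[OF K] by auto
    have "y \<otimes> z \<otimes> x [^] (- (f y + f z)) = y \<otimes> (z \<otimes> x [^] (- f y)) \<otimes> x [^] (- f z)"
      using yz x by (simp add: m_assoc int_pow_mult[symmetric])
    also have "\<dots> = (y \<otimes> k) \<otimes> x [^] (- f y) \<otimes> ?n"
      using yz x k kc by (simp add: m_assoc)
    also have "\<dots> = k' \<otimes> k \<otimes> ?m \<otimes> ?n"
      using yz x k' kc by (simp add: m_assoc)
    finally show "y \<otimes> z \<otimes> x [^] (- (f y + f z)) \<in> M"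
      using k k' KM f yz M by (simp add: subgroup.m_closed subset_iff)
  qed (use x in auto)
  moreover have "[f k = 0] (mod int p)" if "k \<in> K" for k
    using uniq[of k 0] that KM Mc by auto
  moreover have "[f x = 1] (mod int p)"
    using uniq[of x 1] x M by (simp add: int_pow_neg subgroup.one_closed)
  ultimately show ?thesis using that by blast
qed

end

section \<open>Elements inducing homomorphisms modulo a prime\<close>

definition commutator :: "('a, 'b) monoid_scheme \<Rightarrow> 'a \<Rightarrow> 'a \<Rightarrow> 'a" where
  "commutator G x y = x \<otimes>\<^bsub>G\<^esub> y \<otimes>\<^bsub>G\<^esub> inv\<^bsub>G\<^esub> x \<otimes>\<^bsub>G\<^esub> inv\<^bsub>G\<^esub> y"

section \<open>Commutator identities and centralizers\<close>

context group
begin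

lemma inv_cancel_assoc [simp]:
  assumes "x \<in> carrier G" "y \<in> carrier G"
  shows "inv x \<otimes> (x \<otimes> y) = y" "x \<otimes> (inv x \<otimes> y) = y"
  using assms by (simp_all only: m_assoc[symmetric] inv_closed l_inv r_inv l_one)

lemma commutator_closed [simp]:
  "x \<in> carrier G \<Longrightarrow> y \<in> carrier G \<Longrightarrow> commutator G x y \<in> carrier G"
  by (simp add: commutator_def)

lemma mult_eq_commutator_mult:
  "x \<in> carrier G \<Longrightarrow> y \<in> carrier G \<Longrightarrow> x \<otimes> y = commutator G x y \<otimes> (y \<otimes> x)"
  by (simp add: commutator_def m_assoc)

lemma inv_commutator:
  "x \<in> carrier G \<Longrightarrow> y \<in> carrier G \<Longrightarrow> inv (commutator G x y) = commutator G y x"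
  by (simp add: commutator_def inv_mult_group m_assoc)

lemma conj_eq_commutator_mult:
  "x \<in> carrier G \<Longrightarrow> y \<in> carrier G \<Longrightarrow> x \<otimes> y \<otimes> inv x = commutator G x y \<otimes> y"
  by (simp add: commutator_def m_assoc)

text \<open>This form isolates the failure of additivity in a triple commutator, on which the
  functional \<open>\<mu>\<close> used later vanishes.\<close>

lemma commutator_mult_left:
  "x \<in> carrier G \<Longrightarrow> y \<in> carrier G \<Longrightarrow> w \<in> carrier G \<Longrightarrow>
   commutator G (x \<otimes> y) w = commutator G x (commutator G y w) \<otimes> commutator G y w \<otimes> commutator G x w"
  by (simp add: commutator_def inv_mult_group m_assoc)

lemma subgroup_centralizer:
  assumes "S \<subseteq> carrier G"
  shows "subgroup (centralizer G S) G"
proof (rule subgroupI)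
  fix a assume a: "a \<in> centralizer G S"
  have "inv a \<otimes> h = h \<otimes> inv a" if "h \<in> S" for h
  proof -
    have h: "h \<in> carrier G" "a \<in> carrier G" "a \<otimes> h = h \<otimes> a"
      using a that assms by (auto simp: centralizer_def)
    have "inv a \<otimes> h = inv a \<otimes> (h \<otimes> a) \<otimes> inv a" using h(1,2) by (simp add: m_assoc)
    also have "\<dots> = inv a \<otimes> (a \<otimes> h) \<otimes> inv a" by (simp only: h(3))
    also have "\<dots> = h \<otimes> inv a" using h(1,2) by (simp add: m_assoc)
    finally show ?thesis .
  qed
  then show "inv a \<in> centralizer G S" using a by (simp add: centralizer_def)
next
  fix a b assume ab: "a \<in> centralizer G S" "b \<in> centralizer G S"
  have "a \<otimes> b \<otimes> h = h \<otimes> (a \<otimes> b)" if "h \<in> S" for h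
  proof -
    have h: "h \<in> carrier G" "a \<in> carrier G" "a \<otimes> h = h \<otimes> a" "b \<in> carrier G" "b \<otimes> h = h \<otimes> b"
      using ab that assms by (auto simp: centralizer_def)
    have "a \<otimes> b \<otimes> h = a \<otimes> (b \<otimes> h)" using h(1,2,4) by (simp add: m_assoc)
    also have "\<dots> = (a \<otimes> h) \<otimes> b" using h(1,2,4) by (simp add: h(5) m_assoc)
    also have "\<dots> = h \<otimes> (a \<otimes> b)" using h(1,2,4) by (simp add: h(3) m_assoc)
    finally show ?thesis .
  qed
  then show "a \<otimes> b \<in> centralizer G S" using ab by (simp add: centralizer_def)
qed (use assms in \<open>auto simp: centralizer_def subset_iff intro!: exI[of _ \<one>]\<close>)

lemma center_of_eq: "H \<subseteq> carrier G \<Longrightarrow> center_of G H = H \<inter> centralizer G H"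
  by (auto simp: center_of_def centralizer_def)

lemma subgroup_center_of:
  assumes "subgroup H G"
  shows "subgroup (center_of G H) G"
  using subgroups_Inter_pair[OF assms subgroup_centralizer] subgroup.subset[OF assms]
  by (simp add: center_of_eq)

lemma commutator_self: "x \<in> carrier G \<Longrightarrow> commutator G x x = \<one>"
  by (simp add: commutator_def m_assoc)

end

text \<open>The facts on which the construction rests. The Frattini subgroup enters through
  \<open>comm_F\<close>, \<open>comm_L\<close> and \<open>F_ker\<close>, the cyclic center through
  \<open>torsion\<close> and \<open>cyc\<close>, and the hypothesis on derivations through
  \<open>realise\<close>.\<close>

locale frattini_step = group G for G (structure) +
  fixes p :: nat and z :: 'a and F N L :: "'a set"
  assumes fin: "finite (carrier G)" and p_prime: "Factorial_Ring.prime p" and p_odd: "odd p"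
    and F: "subgroup F G" and N: "subgroup N G" and L: "subgroup L G"
    and LN: "L \<subset> N" and NF: "N \<subseteq> F"
    and z_L: "z \<in> L" and z_pow: "z [^] p = \<one>" and z_neq: "z \<noteq> \<one>"
    and z_central: "z \<in> center_of G (carrier G)"
    and torsion: "\<And>x. x \<in> center_of G (carrier G) \<Longrightarrow> x [^] p = \<one> \<Longrightarrow> \<exists>k::int. x = z [^] k"
    and cyc: "\<exists>c \<in> center_of G (carrier G). \<forall>x \<in> center_of G (carrier G). \<exists>k::int. x = c [^] k"
    and center_N: "center_of G (carrier G) \<subseteq> N"
    and pow_L: "\<And>x. x \<in> carrier G \<Longrightarrow> x [^] p \<in> L"
    and comm_F: "\<And>x y. x \<in> carrier G \<Longrightarrow> y \<in> carrier G \<Longrightarrow> commutator G x y \<in> F"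
    and comm_L: "\<And>x u. x \<in> carrier G \<Longrightarrow> u \<in> F \<Longrightarrow> commutator G x u \<in> L"
    and F_ker: "\<And>f u. hom_mod G p f \<Longrightarrow> u \<in> F \<Longrightarrow> [f u = 0] (mod int p)"
    and realise: "\<And>f. hom_mod G p f \<Longrightarrow>
      \<exists>h \<in> center_of G N. \<forall>g \<in> carrier G. h \<otimes> g = g \<otimes> h \<otimes> z [^] f g"
begin

lemma F_carrier: "u \<in> F \<Longrightarrow> u \<in> carrier G" using F by (rule subgroup.mem_carrier)
lemma N_carrier: "u \<in> N \<Longrightarrow> u \<in> carrier G" using N by (rule subgroup.mem_carrier)
lemma L_F: "u \<in> L \<Longrightarrow> u \<in> F" using LN NF by blast

lemma z_carrier [simp]: "z \<in> carrier G" using z_L L by (rule subgroup.mem_carrier[rotated])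

abbreviation Z where "Z \<equiv> center_of G (carrier G)"

lemma subgroup_Z: "subgroup Z G" by (rule subgroup_center_of) (rule subgroup_self)

lemma Z_carrier: "x \<in> Z \<Longrightarrow> x \<in> carrier G" by (simp add: center_of_def)
lemma Z_commute: "x \<in> Z \<Longrightarrow> g \<in> carrier G \<Longrightarrow> x \<otimes> g = g \<otimes> x" by (simp add: center_of_def)

lemma p_gt_0: "p > 0" using p_prime by (simp add: prime_gt_0_nat)

lemma z_pow_Z: "z [^] (k::int) \<in> Z"
  using z_central subgroup_Z by (simp add: subgroup_int_pow_closed)

lemma z_pow_L: "z [^] (k::int) \<in> L" using L z_L by (simp add: subgroup_int_pow_closed)

lemma z_pow_commute: "g \<in> carrier G \<Longrightarrow> z [^] (k::int) \<otimes> g = g \<otimes> z [^] k"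
  by (rule Z_commute[OF z_pow_Z])

lemma z_pow_commute_assoc:
  "g \<in> carrier G \<Longrightarrow> h \<in> carrier G \<Longrightarrow> z [^] (k::int) \<otimes> (g \<otimes> h) = g \<otimes> (z [^] k \<otimes> h)"
  using z_pow_commute[of g k] by (simp add: m_assoc[symmetric])

lemma ord_z: "ord z = p"
proof -
  have "ord z dvd p" using z_pow z_carrier pow_eq_id by blast
  moreover have "ord z \<noteq> 1" using z_neq ord_eq_1 z_carrier by blast
  ultimately show ?thesis using p_prime by (metis prime_nat_iff)
qed

lemma z_pow_eq_one_iff: "z [^] (k::int) = \<one> \<longleftrightarrow> [k = 0] (mod int p)"
  using int_pow_eq_id[OF z_carrier, of k] by (simp add: ord_z cong_0_iff)

lemma z_pow_eq_iff: "z [^] (k::int) = z [^] (l::int) \<longleftrightarrow> [k = l] (mod int p)"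
  using int_pow_eq[OF z_carrier, of k l] by (simp add: ord_z cong_iff_dvd_diff dvd_diff_commute)

text \<open>Equivalently, \<open>inv g \<otimes> h \<otimes> g = h \<otimes> z [^] f g\<close>:
  \<open>h\<close> is central modulo the group generated by \<open>z\<close>, and \<open>f\<close>
  is its pairing with \<open>G\<close>. The swapped form is convenient for moving \<open>h\<close>
  through products.\<close>

definition twists :: "'a \<Rightarrow> ('a \<Rightarrow> int) \<Rightarrow> bool" where
  "twists h f \<longleftrightarrow> h \<in> carrier G \<and> (\<forall>g \<in> carrier G. h \<otimes> g = g \<otimes> h \<otimes> z [^] f g)"

lemma twistsD: "twists h f \<Longrightarrow> g \<in> carrier G \<Longrightarrow> h \<otimes> g = g \<otimes> h \<otimes> z [^] f g"
  by (simp add: twists_def)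

lemma twists_carrier: "twists h f \<Longrightarrow> h \<in> carrier G"
  by (simp add: twists_def)

lemma twists_cong:
  assumes "twists h f" "\<And>g. g \<in> carrier G \<Longrightarrow> [f g = f' g] (mod int p)"
  shows "twists h f'"
proof -
  have "z [^] f g = z [^] f' g" if "g \<in> carrier G" for g
    using assms(2)[OF that] by (simp only: z_pow_eq_iff)
  then show ?thesis using assms(1) by (simp add: twists_def)
qed

lemma twists_Z_iff: "twists h (\<lambda>_. 0) \<longleftrightarrow> h \<in> Z"
  by (auto simp: twists_def center_of_def)

lemma twists_mult:
  assumes "twists h f" "twists h' f'"
  shows "twists (h \<otimes> h') (\<lambda>g. f g + f' g)"
proof -
  have h: "h \<in> carrier G" "h' \<in> carrier G" using assms by (auto dest: twists_carrier)
  have "h \<otimes> h' \<otimes> g = g \<otimes> (h \<otimes> h') \<otimes> z [^] (f g + f' g)" if g: "g \<in> carrier G" for g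
  proof -
    have "h \<otimes> h' \<otimes> g = h \<otimes> (g \<otimes> h' \<otimes> z [^] f' g)"
      using twistsD[OF assms(2) g] h g by (simp add: m_assoc)
    also have "\<dots> = (h \<otimes> g) \<otimes> h' \<otimes> z [^] f' g" using h g by (simp add: m_assoc)
    also have "\<dots> = g \<otimes> (h \<otimes> h') \<otimes> z [^] (f g + f' g)"
      using twistsD[OF assms(1) g] h g by (simp add: m_assoc int_pow_mult z_pow_commute_assoc)
    finally show ?thesis .
  qed
  then show ?thesis using h by (simp add: twists_def)
qed

lemma twists_inv:
  assumes "twists h f"
  shows "twists (inv h) (\<lambda>g. - f g)"
proof -
  have h: "h \<in> carrier G" using assms by (rule twists_carrier)
  have "inv h \<otimes> g = g \<otimes> inv h \<otimes> z [^] (- f g)" if g: "g \<in> carrier G" for g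
  proof -
    have "h \<otimes> (g \<otimes> inv h \<otimes> z [^] (- f g)) = (h \<otimes> g) \<otimes> inv h \<otimes> z [^] (- f g)"
      using h g by (simp add: m_assoc)
    also have "\<dots> = g \<otimes> z [^] f g \<otimes> z [^] (- f g)"
      using twistsD[OF assms g] h g by (simp add: m_assoc z_pow_commute_assoc)
    also have "\<dots> = g" using g by (simp add: m_assoc int_pow_mult[symmetric])
    finally have "inv h \<otimes> (h \<otimes> (g \<otimes> inv h \<otimes> z [^] (- f g))) = inv h \<otimes> g" by simp
    then show ?thesis using h g by simp
  qed
  then show ?thesis using h by (simp add: twists_def)
qed

lemma twists_nat_pow: "twists h f \<Longrightarrow> twists (h [^] (n::nat)) (\<lambda>g. int n * f g)"
proof (induction n)
  case 0
  then show ?case using subgroup.one_closed[OF subgroup_Z] by (simp add: twists_Z_iff)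
next
  case (Suc n)
  then show ?case using twists_mult[of "h [^] n" "\<lambda>g. int n * f g" h f] by (simp add: algebra_simps)
qed

lemma twists_int_pow: "twists h f \<Longrightarrow> twists (h [^] (k::int)) (\<lambda>g. k * f g)"
proof (cases k)
  case (nonneg n)
  assume "twists h f"
  then show ?thesis using twists_nat_pow[of h f n] nonneg by (simp add: int_pow_int)
next
  case (neg n)
  assume h: "twists h f"
  then show ?thesis using twists_inv[OF twists_nat_pow[OF h, of "Suc n"]] unfolding neg(1)
    using int_pow_neg_int[OF twists_carrier[OF h], of "Suc n"] by (simp add: algebra_simps)
qed

text \<open>Move \<open>h\<close> past \<open>x \<otimes> y\<close> in one go and in two, and
  compare the exponents of \<open>z\<close>, which has order \<open>p\<close>.\<close>

lemma twists_hom_mod: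
  assumes "twists h f"
  shows "hom_mod G p f"
  unfolding hom_mod_def
proof (intro ballI)
  fix x y assume xy: "x \<in> carrier G" "y \<in> carrier G"
  have h: "h \<in> carrier G" using assms by (rule twists_carrier)
  have "x \<otimes> y \<otimes> h \<otimes> z [^] f (x \<otimes> y) = h \<otimes> (x \<otimes> y)" using twistsD[OF assms] xy by simp
  also have "\<dots> = x \<otimes> h \<otimes> z [^] f x \<otimes> y"
    using twistsD[OF assms xy(1)] h xy by (simp add: m_assoc[symmetric])
  also have "\<dots> = x \<otimes> (h \<otimes> (z [^] f x \<otimes> y))" using h xy by (simp add: m_assoc)
  also have "\<dots> = x \<otimes> (h \<otimes> y \<otimes> z [^] f x)" using h xy by (simp add: z_pow_commute[OF xy(2)] m_assoc)
  also have "\<dots> = x \<otimes> (y \<otimes> h \<otimes> z [^] f y \<otimes> z [^] f x)" by (simp only: twistsD[OF assms xy(2)])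
  also have "\<dots> = x \<otimes> y \<otimes> h \<otimes> z [^] (f y + f x)" using h xy by (simp add: m_assoc int_pow_mult)
  also have "f y + f x = f x + f y" by simp
  finally have "z [^] f (x \<otimes> y) = z [^] (f x + f y)"
    using h xy by simp
  then show "[f (x \<otimes> y) = f x + f y] (mod int p)" by (simp only: z_pow_eq_iff)
qed

lemma twists_commute_iff:
  assumes "twists h f" "g \<in> carrier G"
  shows "h \<otimes> g = g \<otimes> h \<longleftrightarrow> [f g = 0] (mod int p)"
proof -
  have "h \<otimes> g = g \<otimes> h \<longleftrightarrow> g \<otimes> h \<otimes> z [^] f g = g \<otimes> h \<otimes> \<one>"
    using twistsD[OF assms] twists_carrier[OF assms(1)] assms(2) by simp
  also have "\<dots> \<longleftrightarrow> z [^] f g = \<one>"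
    using twists_carrier[OF assms(1)] assms(2) by simp
  finally show ?thesis by (simp add: z_pow_eq_one_iff)
qed

section \<open>The group \<open>W\<close>, its centralizer \<open>E\<close>, and the duality between
  them\<close>

definition W :: "'a set" where
  "W = {w \<in> center_of G N. w [^] p = \<one> \<and> (\<exists>f. twists w f)}"

lemma W_carrier: "w \<in> W \<Longrightarrow> w \<in> carrier G"
  using N_carrier by (auto simp: W_def center_of_def)

lemma W_N: "w \<in> W \<Longrightarrow> w \<in> N"
  by (auto simp: W_def center_of_def)

lemma W_commute: "w \<in> W \<Longrightarrow> u \<in> N \<Longrightarrow> w \<otimes> u = u \<otimes> w"
  by (auto simp: W_def center_of_def)

lemma W_pow: "w \<in> W \<Longrightarrow> w [^] p = \<one>"
  by (auto simp: W_def)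

lemma subgroup_W: "subgroup W G"
proof (rule subgroupI)
  show "W \<subseteq> carrier G" using W_carrier by blast
  show "W \<noteq> {}"
    using subgroup.one_closed[OF subgroup_center_of[OF N]] subgroup.one_closed[OF subgroup_Z]
    by (auto simp: W_def twists_Z_iff[symmetric] intro!: exI[of _ \<one>])
next
  fix a assume a: "a \<in> W"
  then have "inv a \<in> center_of G N" using subgroup.m_inv_closed[OF subgroup_center_of[OF N]]
    by (simp add: W_def)
  moreover have "inv a [^] p = \<one>" using W_pow[OF a] W_carrier[OF a] by (simp add: nat_pow_inv)
  moreover have "\<exists>f. twists (inv a) f" using a twists_inv by (auto simp: W_def)
  ultimately show "inv a \<in> W" by (simp add: W_def)
next
  fix a b assume ab: "a \<in> W" "b \<in> W"
  then have "a \<otimes> b \<in> center_of G N" using subgroup.m_closed[OF subgroup_center_of[OF N]]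
    by (simp add: W_def)
  moreover have "(a \<otimes> b) [^] p = \<one>"
    using pow_mult_distrib[of a b p] W_commute W_N ab W_pow W_carrier by simp
  moreover have "\<exists>f. twists (a \<otimes> b) f" using ab twists_mult unfolding W_def by blast
  ultimately show "a \<otimes> b \<in> W" by (simp add: W_def)
qed

lemma z_pow_W: "z [^] (k::int) \<in> W"
proof -
  have "z \<in> center_of G N"
    using z_L LN z_central N_carrier by (auto simp: center_of_def)
  then have "z \<in> W" using z_central z_pow by (auto simp: W_def twists_Z_iff[symmetric])
  then show ?thesis by (simp add: subgroup_int_pow_closed subgroup_W)
qed

text \<open>This identifies the kernel of the pairing of \<open>W\<close> with \<open>G\<close>: two
  elements of \<open>W\<close> that induce the same functional differ by a power of
  \<open>z\<close>.\<close>

lemma W_Z: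
  assumes "w \<in> W" "w \<in> Z"
  shows "\<exists>k::int. w = z [^] k"
  using torsion assms W_pow by blast

definition E :: "'a set" where
  "E = {g \<in> carrier G. \<forall>w \<in> W. w \<otimes> g = g \<otimes> w}"

lemma realise_hom_mod:
  assumes "hom_mod G p f"
  obtains h where "h \<in> center_of G N" "twists h f" "h [^] p \<in> Z"
proof -
  obtain h where h: "h \<in> center_of G N" "\<forall>g \<in> carrier G. h \<otimes> g = g \<otimes> h \<otimes> z [^] f g"
    using realise[OF assms] by blast
  then have t: "twists h f" using N_carrier by (auto simp: twists_def center_of_def)
  \<comment> \<open>The \<open>p\<close>-th power induces \<open>p\<close> times \<open>f\<close>,
    which is zero modulo \<open>p\<close>, so it is central.\<close>
  have "twists (h [^] p) (\<lambda>_. 0)"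
    using twists_nat_pow[OF t, of p] by (rule twists_cong) (simp add: cong_0_iff)
  then show ?thesis using that h(1) t by (simp add: twists_Z_iff)
qed

text \<open>The \<open>p\<close>-th powers of elements realising \<open>f\<close> and \<open>f'\<close> lie in the cyclic group \<open>Z\<close>, so some
  nontrivial combination is an element of order \<open>p\<close> up to a central factor.\<close>

lemma combination_in_W:
  assumes f: "hom_mod G p f" and f': "hom_mod G p f'"
  obtains a b w where "\<not> (int p dvd a \<and> int p dvd b)" "w \<in> W" "twists w (\<lambda>g. a * f g + b * f' g)"
proof -
  obtain h where h: "h \<in> center_of G N" "twists h f" "h [^] p \<in> Z" using realise_hom_mod[OF f] .
  obtain h' where h': "h' \<in> center_of G N" "twists h' f'" "h' [^] p \<in> Z" using realise_hom_mod[OF f'] .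
  obtain c where c: "c \<in> Z" "\<forall>x \<in> Z. \<exists>k::int. x = c [^] k" using cyc by blast
  obtain k :: int where k: "h [^] p = c [^] k" using c h by blast
  obtain k' :: int where k': "h' [^] p = c [^] k'" using c h' by blast
  have car: "h \<in> carrier G" "h' \<in> carrier G" "c \<in> carrier G"
    using h h' c by (auto dest: twists_carrier Z_carrier)
  have cN: "c [^] (l::int) \<in> center_of G N" for l
  proof -
    have "c \<in> center_of G N" using c(1) center_N N_carrier by (auto simp: center_of_def)
    then show ?thesis by (simp add: subgroup_int_pow_closed subgroup_center_of[OF N])
  qed
  have cNm: "x \<otimes> y = y \<otimes> x" if "x \<in> center_of G N" "y \<in> center_of G N" for x y
    using that unfolding center_of_def by blast
  have c_tw: "twists (c [^] (l::int)) (\<lambda>_. 0)" for l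
    using c(1) by (simp add: twists_Z_iff subgroup_int_pow_closed subgroup_Z)
  have pw: "(x [^] (l::int)) [^] p = (x [^] p) [^] l" if "x \<in> carrier G" for x l
    using that by (simp add: int_pow_pow int_pow_int[symmetric] mult.commute)
  show ?thesis
  proof (cases "int p dvd k")
    \<comment> \<open>Here \<open>h [^] p\<close> is already the \<open>p\<close>-th power of the
      central element \<open>c [^] j\<close>; dividing \<open>h\<close> by it gives exponent
      \<open>p\<close>, with coefficients one and zero.\<close>
    case True
    then obtain j where j: "k = int p * j" by blast
    let ?w = "h \<otimes> c [^] (- j)"
    have "?w [^] p = h [^] p \<otimes> (c [^] (-j)) [^] p"
      using pow_mult_distrib[OF cNm[OF h(1) cN[of "-j"]]] car by simp
    also have "\<dots> = c [^] k \<otimes> c [^] (- j * int p)"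
      using car k by (simp add: int_pow_pow int_pow_int[symmetric])
    also have "\<dots> = \<one>" using car j by (simp add: int_pow_mult[symmetric] mult.commute)
    finally have "?w [^] p = \<one>" .
    moreover have "?w \<in> center_of G N" using h(1) cN by (simp add: subgroup.m_closed subgroup_center_of[OF N])
    moreover have t: "twists ?w (\<lambda>g. 1 * f g + 0 * f' g)" using twists_mult[OF h(2) c_tw[of "-j"]] by simp
    ultimately have "?w \<in> W" by (auto simp: W_def)
    moreover have "\<not> int p dvd 1" using p_prime by auto
    ultimately show ?thesis using that t by blast
  next
    \<comment> \<open>The \<open>p\<close>-th powers of \<open>h [^] k'\<close> and
      \<open>h' [^] k\<close> are both \<open>c [^] (k * k')\<close>, so their quotient has exponent
      \<open>p\<close>; its coefficient \<open>- k\<close> is nonzero modulo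
      \<open>p\<close>.\<close>
    case False
    let ?w = "h [^] k' \<otimes> h' [^] (- k)"
    have hc: "h [^] k' \<in> center_of G N" "h' [^] (-k) \<in> center_of G N"
      using h(1) h'(1) by (simp_all add: subgroup_int_pow_closed subgroup_center_of[OF N])
    have "?w [^] p = (h [^] k') [^] p \<otimes> (h' [^] (-k)) [^] p"
      using pow_mult_distrib[OF cNm[OF hc]] car by simp
    also have "\<dots> = c [^] (k * k') \<otimes> c [^] (k' * (- k))"
      using car k k' pw by (simp add: int_pow_pow)
    also have "\<dots> = \<one>" using car by (simp add: int_pow_mult[symmetric])
    finally have "?w [^] p = \<one>" .
    moreover have "?w \<in> center_of G N" using hc by (simp add: subgroup.m_closed subgroup_center_of[OF N])
    moreover have t: "twists ?w (\<lambda>g. k' * f g + (- k) * f' g)"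
      by (rule twists_mult[OF twists_int_pow[OF h(2)] twists_int_pow[OF h'(2)]])
    ultimately have "?w \<in> W" by (auto simp: W_def)
    moreover have "\<not> int p dvd - k" using False by simp
    ultimately show ?thesis using that t by blast
  qed
qed

text \<open>Let \<open>e\<close> in \<open>E\<close> lie outside \<open>F\<close>, and suppose some
  \<open>e'\<close> in \<open>E\<close> lies outside the group generated by \<open>F\<close> and
  \<open>e\<close>. Take \<open>f\<close> vanishing on that group with \<open>f e' = 1\<close>, and
  \<open>f'\<close> with \<open>f' e = 1\<close>. A nontrivial combination of them is induced from
  \<open>W\<close>, hence vanishes on \<open>E\<close>, and its values at \<open>e\<close> and
  \<open>e'\<close> make both coefficients zero. The alternative \<open>e = \<one>\<close> covers
  the case that \<open>E\<close> lies in \<open>F\<close>.\<close>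

lemma E_cyclic:
  obtains e where "e \<in> carrier G" "e = \<one> \<or> e \<notin> F" "E \<subseteq> {u \<otimes> e [^] (k::int) | u k. u \<in> F}"
proof (cases "E \<subseteq> F")
  case True
  have "E \<subseteq> {u \<otimes> \<one> [^] (k::int) | u k. u \<in> F}"
  proof
    fix u assume "u \<in> E"
    then have "u \<in> F" "u = u \<otimes> \<one> [^] (0::int)" using True F_carrier by auto
    then show "u \<in> {u \<otimes> \<one> [^] (k::int) | u k. u \<in> F}" by blast
  qed
  then show ?thesis using that[of \<one>] by simp
next
  case False
  then obtain e where e: "e \<in> E" "e \<notin> F" by blast
  then have ec: "e \<in> carrier G" by (simp add: E_def)
  let ?K = "{u \<otimes> e [^] (k::int) | u k. u \<in> F}"
  have "y \<otimes> u \<otimes> inv y \<in> F" if "y \<in> carrier G" "u \<in> F" for y u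
    using that comm_F[of y u] F_carrier F by (simp add: conj_eq_commutator_mult subgroup.m_closed)
  then have K: "subgroup ?K G" "F \<subseteq> ?K" "e \<in> ?K" using subgroup_adjoin[OF F ec] ec by auto
  have comm: "\<exists>k \<in> F. a \<otimes> b = k \<otimes> (b \<otimes> a)" if "a \<in> carrier G" "b \<in> carrier G" for a b
    using comm_F[OF that] mult_eq_commutator_mult[OF that] by blast
  have "E \<subseteq> ?K"
  proof
    fix e' assume e': "e' \<in> E"
    then have e'c: "e' \<in> carrier G" by (simp add: E_def)
    show "e' \<in> ?K"
    proof (rule ccontr)
      assume "e' \<notin> ?K"
      have comm': "\<exists>k \<in> ?K. a \<otimes> b = k \<otimes> (b \<otimes> a)" if "a \<in> carrier G" "b \<in> carrier G" for a b
        using comm[OF that] K(2) by (meson subsetD)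
      have pow': "a [^] p \<in> ?K" if "a \<in> carrier G" for a
        using pow_L[OF that] L_F K(2) by (meson subsetD)
      obtain f where f: "hom_mod G p f" "\<And>k. k \<in> ?K \<Longrightarrow> [f k = 0] (mod int p)"
          "[f e' = 1] (mod int p)"
        using hom_mod_separating[OF fin p_prime K(1) comm' pow' e'c \<open>e' \<notin> ?K\<close>] by blast
      obtain f' where f': "hom_mod G p f'" "\<And>k. k \<in> F \<Longrightarrow> [f' k = 0] (mod int p)"
          "[f' e = 1] (mod int p)"
        using hom_mod_separating[OF fin p_prime F comm L_F[OF pow_L] ec e(2)] by blast
      obtain a b w where ab: "\<not> (int p dvd a \<and> int p dvd b)" "w \<in> W"
        and t: "twists w (\<lambda>g. a * f g + b * f' g)"
        using combination_in_W[OF f(1) f'(1)] .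
      \<comment> \<open>Evaluation at \<open>e\<close>, where \<open>f\<close> vanishes, kills
        \<open>b\<close>; evaluation at \<open>e'\<close> then kills \<open>a\<close>.\<close>
      have "[a * f e + b * f' e = 0] (mod int p)"
        using twists_commute_iff[OF t ec] e(1) ab(2) by (simp add: E_def)
      moreover have "[a * f e + b * f' e = a * 0 + b * 1] (mod int p)"
        using f(2)[OF K(3)] f'(3) by (intro cong_add cong_mult cong_refl) auto
      ultimately have b: "[b = 0] (mod int p)" by (metis cong_sym cong_trans mult.right_neutral mult_zero_right add_0)
      have "[a * f e' + b * f' e' = 0] (mod int p)"
        using twists_commute_iff[OF t e'c] e' ab(2) by (simp add: E_def)
      moreover have "[a * f e' + b * f' e' = a * 1 + 0 * f' e'] (mod int p)"
        using f(3) b by (intro cong_add cong_mult cong_refl) auto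
      ultimately have "[a = 0] (mod int p)" by (metis cong_sym cong_trans mult.right_neutral mult_zero_left add_0_right)
      then show False using b ab(1) by (simp add: cong_0_iff)
    qed
  qed
  then show ?thesis using that ec e(2) by blast
qed

text \<open>Duality between \<open>W\<close> and \<open>G\<close>; the induction cuts down the subgroup \<open>H\<close> by one
  centralizer at a time.\<close>

lemma realise_on_subgroup:
  assumes "finite S" "S \<subseteq> W" "subgroup H G" "hom_mod (G\<lparr>carrier := H\<rparr>) p f"
    "\<And>g. g \<in> H \<Longrightarrow> (\<And>w. w \<in> S \<Longrightarrow> w \<otimes> g = g \<otimes> w) \<Longrightarrow> [f g = 0] (mod int p)"
  shows "\<exists>w \<in> W. \<exists>f'. twists w f' \<and> (\<forall>g \<in> H. [f' g = f g] (mod int p))"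
  using assms
proof (induction S arbitrary: H f rule: finite_induct)
  \<comment> \<open>For empty \<open>S\<close> the last hypothesis says that \<open>f\<close>
    vanishes on \<open>H\<close>, so the identity realises it.\<close>
  case empty
  then have "[0 = f g] (mod int p)" if "g \<in> H" for g using that by (auto intro: cong_sym)
  moreover have "twists \<one> (\<lambda>_. 0)" using subgroup.one_closed[OF subgroup_Z] by (simp add: twists_Z_iff)
  moreover have "\<one> \<in> W" using subgroup_W by (rule subgroup.one_closed)
  ultimately show ?case by blast
next
  case (insert s S)
  note H = \<open>subgroup H G\<close> and f = \<open>hom_mod (G\<lparr>carrier := H\<rparr>) p f\<close>
  have Hc: "g \<in> carrier G" if "g \<in> H" for g using subgroup.mem_carrier[OF H that] .
  have sW: "s \<in> W" using insert.prems by blast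
  then obtain \<sigma> where \<sigma>: "twists s \<sigma>" by (auto simp: W_def)
  \<comment> \<open>The elements of \<open>H\<close> that commute with \<open>s\<close>; to these
    the induction hypothesis for \<open>S\<close> applies.\<close>
  define H' where "H' = H \<inter> {g \<in> carrier G. [\<sigma> g = 0] (mod int p)}"
  have H': "subgroup H' G"
    unfolding H'_def by (rule subgroups_Inter_pair[OF H hom_mod_kernel[OF twists_hom_mod[OF \<sigma>]]])
  have "hom_mod (G\<lparr>carrier := H'\<rparr>) p f"
    using f by (simp add: hom_mod_def H'_def)
  moreover have "[f g = 0] (mod int p)" if "g \<in> H'" "\<And>w. w \<in> S \<Longrightarrow> w \<otimes> g = g \<otimes> w" for g
    using that insert.prems(4)[of g] twists_commute_iff[OF \<sigma>, of g] by (auto simp: H'_def)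
  ultimately obtain w' f' where w': "w' \<in> W" "twists w' f'" "\<forall>g \<in> H'. [f' g = f g] (mod int p)"
    using insert.IH[OF _ H'] insert.prems(1) by (metis insert_subset)
  show ?case
  proof (cases "H' = H")
    case True
    then show ?thesis using w' by blast
  next
    case False
    then obtain g0 where g0: "g0 \<in> H" "\<not> int p dvd \<sigma> g0"
      using Hc by (auto simp: H'_def cong_0_iff)
    obtain l where l: "[\<sigma> g0 * l = 1] (mod int p)" using cong_inverse_prime[OF p_prime g0(2)] .
    \<comment> \<open>What \<open>w'\<close> fails to realise. It vanishes on \<open>H'\<close>, the
      kernel of \<open>\<sigma>\<close> in \<open>H\<close>, so it is a multiple of
      \<open>\<sigma>\<close>.\<close>
    define \<gamma> where "\<gamma> g = 1 * f g + (-1) * f' g" for g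
    have f'H: "hom_mod (G\<lparr>carrier := H\<rparr>) p f'"
      using twists_hom_mod[OF w'(2)] Hc by (simp add: hom_mod_def)
    have \<gamma>: "hom_mod (G\<lparr>carrier := H\<rparr>) p \<gamma>"
      unfolding \<gamma>_def by (rule hom_mod_lin[OF f f'H])
    have \<gamma>0: "[\<gamma> g = 0] (mod int p)" if "g \<in> H'" for g
      using w'(3) that by (simp add: \<gamma>_def cong_iff_dvd_diff dvd_diff_commute)
    \<comment> \<open>The factor of proportionality, \<open>\<gamma> g0\<close> divided by
      \<open>\<sigma> g0\<close>; multiplying \<open>w'\<close> by \<open>s [^] m\<close> makes up
      for it.\<close>
    define m where "m = l * \<gamma> g0"
    have "[f' g + m * \<sigma> g = f g] (mod int p)" if g: "g \<in> H" for g
    proof -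
      \<comment> \<open>Chosen so that \<open>\<sigma>\<close> vanishes at
        \<open>g \<otimes> g0 [^] (- n)\<close>, which therefore lies in \<open>H'\<close>.\<close>
      define n where "n = l * \<sigma> g"
      have H_pow: "g0 [^] k \<in> H" for k :: int using g0(1) H by (simp add: subgroup_int_pow_closed)
      let ?g = "g \<otimes> g0 [^] (- n)"
      have "[\<sigma> ?g = \<sigma> g + (- n) * \<sigma> g0] (mod int p)"
        using hom_modD[OF twists_hom_mod[OF \<sigma>], of g "g0 [^] (-n)"]
          cong_add[OF cong_refl[of "\<sigma> g"] hom_mod_int_pow[OF twists_hom_mod[OF \<sigma>], of g0 "-n"]] Hc g g0
        by (blast intro: cong_trans)
      also have "\<sigma> g + (- n) * \<sigma> g0 = \<sigma> g + (- \<sigma> g) * (\<sigma> g0 * l)"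
        by (simp add: n_def algebra_simps)
      also have "[\<sigma> g + (- \<sigma> g) * (\<sigma> g0 * l) = \<sigma> g + (- \<sigma> g) * 1] (mod int p)"
        by (rule cong_add[OF cong_refl cong_mult[OF cong_refl l]])
      finally have "?g \<in> H'"
        using g Hc H_pow H by (simp add: H'_def subgroup.m_closed)
      then have "[0 = \<gamma> ?g] (mod int p)" using \<gamma>0 cong_sym by blast
      also have "[\<gamma> ?g = \<gamma> g + \<gamma> (g0 [^] (- n))] (mod int p)"
        using hom_modD[OF \<gamma>, of g "g0 [^] (- n)"] g H_pow by simp
      also have "[\<gamma> g + \<gamma> (g0 [^] (- n)) = \<gamma> g + (- n) * \<gamma> g0] (mod int p)"
        using group.hom_mod_int_pow[OF subgroup_imp_group[OF H] \<gamma>, of g0 "- n"] g0(1)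
          int_pow_consistent[OF H g0(1), of "- n"] by (intro cong_add cong_refl) simp
      also have "\<gamma> g + (- n) * \<gamma> g0 = f g - (f' g + m * \<sigma> g)"
        by (simp add: \<gamma>_def m_def n_def algebra_simps)
      finally have "int p dvd f g - (f' g + m * \<sigma> g)" by (simp add: cong_0_iff cong_sym_eq[of 0])
      then show ?thesis by (simp add: cong_iff_dvd_diff dvd_diff_commute)
    qed
    moreover have "twists (w' \<otimes> s [^] m) (\<lambda>g. f' g + m * \<sigma> g)"
      using twists_mult[OF w'(2) twists_int_pow[OF \<sigma>]] .
    moreover have "w' \<otimes> s [^] m \<in> W"
      using w'(1) sW by (simp add: subgroup.m_closed subgroup_int_pow_closed subgroup_W)
    ultimately show ?thesis by blast
  qed
qed

text \<open>\<open>E\<close> is the common centralizer of \<open>W\<close>, so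
  \<open>realise_on_subgroup\<close> applies with \<open>W\<close> as \<open>S\<close> and the whole
  group as \<open>H\<close>.\<close>

lemma realise_in_W:
  assumes f: "hom_mod G p f" and fE: "\<And>g. g \<in> E \<Longrightarrow> [f g = 0] (mod int p)"
  obtains w where "w \<in> W" "twists w f"
proof -
  have "finite W" using W_carrier fin by (meson finite_subset subsetI)
  moreover have "[f g = 0] (mod int p)" if "g \<in> carrier G" "\<And>w. w \<in> W \<Longrightarrow> w \<otimes> g = g \<otimes> w" for g
    using fE that by (simp add: E_def)
  ultimately obtain w f' where "w \<in> W" "twists w f'" "\<forall>g \<in> carrier G. [f' g = f g] (mod int p)"
    using realise_on_subgroup[of W "carrier G" f] subgroup_self f by auto
  then show ?thesis using that twists_cong by blast
qed

end

section \<open>The alternating form and the derivation\<close>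

context frattini_step
begin

lemma hom_mod_FD:
  assumes "hom_mod (G\<lparr>carrier := F\<rparr>) p \<mu>" "u \<in> F" "v \<in> F"
  shows "[\<mu> (u \<otimes> v) = \<mu> u + \<mu> v] (mod int p)"
  using hom_modD[OF assms(1), of u v] assms by simp

text \<open>The quotient F/L is elementary abelian by \<open>comm_L\<close> and
  \<open>pow_L\<close>, so \<open>hom_mod_separating\<close>, applied inside the group
  \<open>F\<close>, separates an element of \<open>N\<close> from \<open>L\<close>.\<close>

lemma functional:
  obtains \<mu> x where "hom_mod (G\<lparr>carrier := F\<rparr>) p \<mu>" "\<And>u. u \<in> L \<Longrightarrow> [\<mu> u = 0] (mod int p)"
    "x \<in> N" "[\<mu> x = 1] (mod int p)"
proof -
  obtain x where x: "x \<in> N" "x \<notin> L" using LN by blast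
  interpret F: group "G\<lparr>carrier := F\<rparr>" using F by (rule subgroup_imp_group)
  have fin': "finite (carrier (G\<lparr>carrier := F\<rparr>))"
    using finite_subset[OF subgroup.subset[OF F] fin] by simp
  have L': "subgroup L (G\<lparr>carrier := F\<rparr>)"
    using L F L_F by (intro subgroup_incl) auto
  have comm: "\<exists>k \<in> L. a \<otimes>\<^bsub>G\<lparr>carrier := F\<rparr>\<^esub> b = k \<otimes>\<^bsub>G\<lparr>carrier := F\<rparr>\<^esub> (b \<otimes>\<^bsub>G\<lparr>carrier := F\<rparr>\<^esub> a)"
    if "a \<in> carrier (G\<lparr>carrier := F\<rparr>)" "b \<in> carrier (G\<lparr>carrier := F\<rparr>)" for a b
    using that comm_L[of a b] mult_eq_commutator_mult[of a b] F_carrier by auto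
  have pow: "a [^]\<^bsub>G\<lparr>carrier := F\<rparr>\<^esub> p \<in> L" if "a \<in> carrier (G\<lparr>carrier := F\<rparr>)" for a
    using that pow_L[of a] F_carrier nat_pow_consistent[of a p F] by simp
  have x': "x \<in> carrier (G\<lparr>carrier := F\<rparr>)" using x NF by auto
  show ?thesis
    by (rule F.hom_mod_separating[OF fin' p_prime L' comm pow x' x(2)]) (assumption | rule that[OF _ _ x(1)])+
qed

end

section \<open>The alternating form of a functional, and a bilinear form that antisymmetrises to
  it\<close>

locale frattini_step_functional = frattini_step +
  fixes \<mu> :: "'a \<Rightarrow> int"
  assumes \<mu>: "hom_mod (G\<lparr>carrier := F\<rparr>) p \<mu>" and \<mu>_L: "\<And>u. u \<in> L \<Longrightarrow> [\<mu> u = 0] (mod int p)"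
begin

definition c :: "'a \<Rightarrow> 'a \<Rightarrow> int" where "c x y = \<mu> (commutator G x y)"

text \<open>In \<open>commutator_mult_left\<close> the triple commutator lies in \<open>L\<close> by
  \<open>comm_L\<close>, and \<open>\<mu>\<close> vanishes there; the remaining factors add
  up.\<close>

lemma c_left: "hom_mod G p (\<lambda>x. c x y)" if y: "y \<in> carrier G"
  unfolding hom_mod_def
proof (intro ballI)
  fix x w assume xw: "x \<in> carrier G" "w \<in> carrier G"
  let ?u = "commutator G w y" and ?v = "commutator G x y"
  have F': "?u \<in> F" "?v \<in> F" using comm_F xw y by auto
  have L': "commutator G x ?u \<in> L" using comm_L xw F' by blast
  have "c (x \<otimes> w) y = \<mu> (commutator G x ?u \<otimes> ?u \<otimes> ?v)"
    using commutator_mult_left[OF xw y] by (simp add: c_def)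
  also have "[\<mu> (commutator G x ?u \<otimes> ?u \<otimes> ?v) = \<mu> (commutator G x ?u \<otimes> ?u) + \<mu> ?v] (mod int p)"
    using hom_mod_FD[OF \<mu>] F' L_F[OF L'] F by (simp add: subgroup.m_closed)
  also have "[\<mu> (commutator G x ?u \<otimes> ?u) + \<mu> ?v = (\<mu> (commutator G x ?u) + \<mu> ?u) + \<mu> ?v] (mod int p)"
    by (rule cong_add[OF hom_mod_FD[OF \<mu> L_F[OF L'] F'(1)] cong_refl])
  also have "[(\<mu> (commutator G x ?u) + \<mu> ?u) + \<mu> ?v = (0 + \<mu> ?u) + \<mu> ?v] (mod int p)"
    by (rule cong_add[OF cong_add[OF \<mu>_L[OF L'] cong_refl] cong_refl])
  finally show "[c (x \<otimes> w) y = c x y + c w y] (mod int p)" by (simp add: c_def add.commute)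
qed

lemma \<mu>_one: "[\<mu> \<one> = 0] (mod int p)"
  using \<mu>_L L subgroup.one_closed by blast

lemma c_anti:
  assumes "x \<in> carrier G" "y \<in> carrier G"
  shows "[c x y + c y x = 0] (mod int p)"
proof -
  have "[\<mu> (commutator G x y \<otimes> commutator G y x) = c x y + c y x] (mod int p)"
    unfolding c_def using assms comm_F by (intro hom_mod_FD[OF \<mu>]) auto
  moreover have "commutator G x y \<otimes> commutator G y x = \<one>"
    using assms by (simp add: inv_commutator[OF assms, symmetric])
  ultimately have "[\<mu> \<one> = c x y + c y x] (mod int p)" by simp
  then show ?thesis using \<mu>_one by (blast intro: cong_sym cong_trans)
qed

lemma c_self: "x \<in> carrier G \<Longrightarrow> [c x x = 0] (mod int p)"
  using \<mu>_one by (simp add: c_def commutator_self)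

lemma c_right: "hom_mod G p (c x)" if x: "x \<in> carrier G"
  unfolding hom_mod_def
proof (intro ballI)
  fix y w assume yw: "y \<in> carrier G" "w \<in> carrier G"
  have swap: "[c x v = - c v x] (mod int p)" if "v \<in> carrier G" for v
    using c_anti[OF x that] by (simp add: cong_iff_dvd_diff)
  have "[c x (y \<otimes> w) = - c (y \<otimes> w) x] (mod int p)" using swap yw by simp
  also have "[- c (y \<otimes> w) x = - (c y x + c w x)] (mod int p)"
    using hom_modD[OF c_left[OF x] yw] by (simp only: cong_minus_minus_iff)
  also have "- (c y x + c w x) = - c y x + - c w x" by simp
  also have "[- c y x + - c w x = c x y + c x w] (mod int p)"
    using swap yw by (intro cong_add cong_sym[OF swap]) auto
  finally show "[c x (y \<otimes> w) = c x y + c x w] (mod int p)" .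
qed

text \<open>If \<open>E\<close> is generated by \<open>e\<close> modulo \<open>F\<close> and \<open>\<epsilon>\<close> is a functional with \<open>\<epsilon> e = 1\<close>, then
  \<open>\<epsilon> x * c e y + \<epsilon> y * c e x\<close> is the symmetric correction that makes \<open>c\<close> vanish on \<open>e\<close>.\<close>

lemma bilinear_form:
  obtains B where "\<And>x. x \<in> carrier G \<Longrightarrow> hom_mod G p (B x)"
    "\<And>y. y \<in> carrier G \<Longrightarrow> hom_mod G p (\<lambda>x. B x y)"
    "\<And>x y. x \<in> carrier G \<Longrightarrow> y \<in> carrier G \<Longrightarrow> [B x y = c x y + B y x] (mod int p)"
    "\<And>x y. x \<in> carrier G \<Longrightarrow> y \<in> E \<Longrightarrow> [B x y = 0] (mod int p)"
proof -
  obtain e where e: "e \<in> carrier G" "e = \<one> \<or> e \<notin> F" "E \<subseteq> {u \<otimes> e [^] (k::int) | u k. u \<in> F}"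
    using E_cyclic .
  \<comment> \<open>For \<open>e = \<one>\<close> no normalisation is asked for and zero serves;
    otherwise \<open>e\<close> is separated from \<open>F\<close>.\<close>
  have "\<exists>\<epsilon>. hom_mod G p \<epsilon> \<and> (e = \<one> \<or> [\<epsilon> e = 1] (mod int p))"
  proof (cases "e = \<one>")
    case True
    moreover have "hom_mod G p (\<lambda>_. 0)" by (simp add: hom_mod_def)
    ultimately show ?thesis by blast
  next
    case False
    have comm: "\<exists>k \<in> F. a \<otimes> b = k \<otimes> (b \<otimes> a)" if "a \<in> carrier G" "b \<in> carrier G" for a b
      using comm_F[OF that] mult_eq_commutator_mult[OF that] by blast
    have "e \<notin> F" using e(2) False by blast
    then obtain \<epsilon> where "hom_mod G p \<epsilon>" "[\<epsilon> e = 1] (mod int p)"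
      using hom_mod_separating[OF fin p_prime F comm L_F[OF pow_L] e(1)] by blast
    then show ?thesis by blast
  qed
  then obtain \<epsilon> where \<epsilon>: "hom_mod G p \<epsilon>" "e = \<one> \<or> [\<epsilon> e = 1] (mod int p)" by blast
  \<comment> \<open>The inverse of two modulo \<open>p\<close>; this uses that \<open>p\<close> is
    odd.\<close>
  define t where "t = (int p + 1) div 2"
  obtain m where "p = 2 * m + 1" using p_odd by (rule oddE)
  then have t: "2 * t = int p + 1" by (simp add: t_def)
  \<comment> \<open>Half the sum of \<open>c\<close> and the symmetric correction, bracketed as
    linear combinations for \<open>hom_mod_lin\<close>.\<close>
  define B where "B x y = t * (1 * c x y + \<epsilon> x * c e y) + (t * c e x) * \<epsilon> y" for x y
  have B_right: "hom_mod G p (B x)" if "x \<in> carrier G" for x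
    unfolding B_def by (rule hom_mod_lin[OF hom_mod_lin[OF c_right[OF that] c_right[OF e(1)]] \<epsilon>(1)])
  have B_left: "hom_mod G p (\<lambda>x. B x y)" if "y \<in> carrier G" for y
  proof -
    have "B x y = t * (1 * c x y + c e y * \<epsilon> x) + (t * \<epsilon> y) * c e x" for x
      by (simp add: B_def algebra_simps)
    moreover have "hom_mod G p (\<lambda>x. t * (1 * c x y + c e y * \<epsilon> x) + (t * \<epsilon> y) * c e x)"
      by (rule hom_mod_lin[OF hom_mod_lin[OF c_left[OF that] \<epsilon>(1)] c_right[OF e(1)]])
    ultimately show ?thesis by presburger
  qed
  have "[B x y = c x y + B y x] (mod int p)" if xy: "x \<in> carrier G" "y \<in> carrier G" for x y
  proof -
    \<comment> \<open>The correction is symmetric and cancels in \<open>B x y - B y x\<close>,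
      leaving \<open>t * (c x y - c y x)\<close>; antisymmetry of \<open>c\<close> turns this into
      \<open>c x y\<close>.\<close>
    have "B x y - (c x y + B y x) = (2 * t - 1) * c x y - t * (c x y + c y x)"
      by (simp add: B_def algebra_simps)
    also have "\<dots> = int p * c x y - t * (c x y + c y x)" by (simp add: t)
    finally show ?thesis using c_anti[OF xy] by (simp add: cong_iff_dvd_diff)
  qed
  moreover have "[B x y = 0] (mod int p)" if x: "x \<in> carrier G" and y: "y \<in> E" for x y
  proof -
    obtain u k where uk: "u \<in> F" "y = u \<otimes> e [^] (k::int)" using e(3) y by blast
    have Bxe: "[B x e = 0] (mod int p)"
    proof (cases "e = \<one>")
      case True
      then show ?thesis using hom_mod_one[OF B_right[OF x]] by simp
    next
      case False
      then have "int p dvd \<epsilon> e - 1" using \<epsilon>(2) by (simp add: cong_iff_dvd_diff)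
      moreover have "int p dvd c e e" "int p dvd c x e + c e x"
        using c_self[OF e(1)] c_anti[OF x e(1)] by (simp_all add: cong_0_iff)
      \<comment> \<open>Each summand has a factor that is zero modulo \<open>p\<close>: by
        antisymmetry of \<open>c\<close>, because \<open>c\<close> is alternating, and by the
        normalisation of \<open>\<epsilon>\<close> at \<open>e\<close>.\<close>
      moreover have "B x e = t * (c x e + c e x) + t * \<epsilon> x * c e e + (t * c e x) * (\<epsilon> e - 1)"
        by (simp add: B_def algebra_simps)
      ultimately show ?thesis by (simp add: cong_0_iff)
    qed
    \<comment> \<open>\<open>B x\<close> vanishes on \<open>F\<close>, so on \<open>E\<close> only
      its value at \<open>e\<close> counts.\<close>
    have "[B x y = B x u + B x (e [^] k)] (mod int p)"
      unfolding uk(2) using F_carrier[OF uk(1)] e(1) by (intro hom_modD[OF B_right[OF x]]) auto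
    also have "[B x u + B x (e [^] k) = 0 + k * B x e] (mod int p)"
      by (rule cong_add[OF F_ker[OF B_right[OF x] uk(1)] hom_mod_int_pow[OF B_right[OF x] e(1)]])
    also have "[0 + k * B x e = 0 + k * 0] (mod int p)"
      by (rule cong_add[OF cong_refl cong_mult[OF cong_refl Bxe]])
    finally show ?thesis by simp
  qed
  ultimately show ?thesis using that B_right B_left by blast
qed

end

section \<open>The central extension of \<open>G\<close> by the powers of \<open>z\<close>, and a
  complement in it\<close>

locale frattini_step_form = frattini_step_functional +
  fixes B :: "'a \<Rightarrow> 'a \<Rightarrow> int"
  assumes B_right: "\<And>x. x \<in> carrier G \<Longrightarrow> hom_mod G p (B x)"
    and B_left: "\<And>y. y \<in> carrier G \<Longrightarrow> hom_mod G p (\<lambda>x. B x y)"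
    and B_swap: "\<And>x y. x \<in> carrier G \<Longrightarrow> y \<in> carrier G \<Longrightarrow> [B x y = c x y + B y x] (mod int p)"
    and B_E: "\<And>x y. x \<in> carrier G \<Longrightarrow> y \<in> E \<Longrightarrow> [B x y = 0] (mod int p)"
begin

text \<open>This is a subgroup of the semidirect product of \<open>G\<close> and \<open>W\<close>: the conjugate
  \<open>inv y \<otimes> w \<otimes> y\<close> in the product \<open>(x, w) (y, v) = (x \<otimes> y, inv y \<otimes> w \<otimes> y \<otimes> v)\<close> equals
  \<open>w \<otimes> z [^] B x y\<close>.\<close>

definition Tw :: "('a \<times> 'a) monoid" where
  "Tw = \<lparr>carrier = {(g, w). g \<in> carrier G \<and> w \<in> W \<and> twists w (B g)},
     monoid.mult = (\<lambda>(x, w) (y, v). (x \<otimes> y, w \<otimes> v \<otimes> z [^] B x y)), one = (\<one>, \<one>)\<rparr>"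

lemma Tw_carrier: "(g, w) \<in> carrier Tw \<longleftrightarrow> g \<in> carrier G \<and> w \<in> W \<and> twists w (B g)"
  by (simp add: Tw_def)

lemma Tw_mult: "(x, w) \<otimes>\<^bsub>Tw\<^esub> (y, v) = (x \<otimes> y, w \<otimes> v \<otimes> z [^] B x y)"
  by (simp add: Tw_def)

lemma Tw_one: "\<one>\<^bsub>Tw\<^esub> = (\<one>, \<one>)" by (simp add: Tw_def)

lemma W_mult_commute: "v \<in> W \<Longrightarrow> w \<in> W \<Longrightarrow> v \<otimes> w = w \<otimes> v"
  by (rule W_commute[OF _ W_N])

lemma twists_mult_z_pow:
  assumes "twists w f"
  shows "twists (w \<otimes> z [^] (k::int)) f"
proof -
  have "twists (z [^] k) (\<lambda>_. 0)" using z_pow_Z by (simp only: twists_Z_iff)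
  from twists_mult[OF assms this] show ?thesis by simp
qed

lemma B_mult_left:
  "x \<in> carrier G \<Longrightarrow> y \<in> carrier G \<Longrightarrow> w \<in> carrier G \<Longrightarrow> [B (x \<otimes> y) w = B x w + B y w] (mod int p)"
  using hom_modD[OF B_left] by blast

lemma B_mult_right:
  "x \<in> carrier G \<Longrightarrow> y \<in> carrier G \<Longrightarrow> w \<in> carrier G \<Longrightarrow> [B w (x \<otimes> y) = B w x + B w y] (mod int p)"
  using hom_modD[OF B_right] by blast

lemma B_F_left: "u \<in> F \<Longrightarrow> y \<in> carrier G \<Longrightarrow> [B u y = 0] (mod int p)"
  using F_ker[OF B_left] by blast

lemma B_F_right: "u \<in> F \<Longrightarrow> y \<in> carrier G \<Longrightarrow> [B y u = 0] (mod int p)"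
  using F_ker[OF B_right] by blast

lemma one_F: "\<one> \<in> F" using F by (rule subgroup.one_closed)

lemma z_pow_B_F: "u \<in> F \<Longrightarrow> y \<in> carrier G \<Longrightarrow> z [^] B u y = \<one>" "u \<in> F \<Longrightarrow> y \<in> carrier G \<Longrightarrow> z [^] B y u = \<one>"
  using B_F_left B_F_right by (simp_all add: z_pow_eq_one_iff)

text \<open>Closure comes from additivity of \<open>B\<close> in its first argument. Associativity
  is the cocycle identity \<open>B x y + B (x \<otimes> y) s = B y s + B x (y \<otimes> s)\<close>
  modulo \<open>p\<close>, which holds for every bilinear form.\<close>

lemma group_Tw: "group Tw"
proof (rule groupI)
  fix a b assume ab: "a \<in> carrier Tw" "b \<in> carrier Tw"
  obtain x w y v where [simp]: "a = (x, w)" "b = (y, v)" by fastforce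
  have xw: "x \<in> carrier G" "w \<in> W" "twists w (B x)" and yv: "y \<in> carrier G" "v \<in> W" "twists v (B y)"
    using ab by (auto simp: Tw_carrier)
  have "twists (w \<otimes> v) (B (x \<otimes> y))"
    by (rule twists_cong[OF twists_mult[OF xw(3) yv(3)]])
      (use B_mult_left xw(1) yv(1) cong_sym in blast)
  then have "twists (w \<otimes> v \<otimes> z [^] B x y) (B (x \<otimes> y))" by (rule twists_mult_z_pow)
  moreover have "w \<otimes> v \<otimes> z [^] B x y \<in> W"
    using xw yv z_pow_W by (simp add: subgroup.m_closed subgroup_W)
  ultimately show "a \<otimes>\<^bsub>Tw\<^esub> b \<in> carrier Tw" using xw yv by (simp add: Tw_mult Tw_carrier)
next
  have "twists \<one> (\<lambda>_. 0)" using subgroup.one_closed[OF subgroup_Z] by (simp only: twists_Z_iff)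
  then have "twists \<one> (B \<one>)" by (rule twists_cong) (use B_F_left one_F cong_sym in blast)
  then show "\<one>\<^bsub>Tw\<^esub> \<in> carrier Tw" using subgroup.one_closed[OF subgroup_W] by (simp add: Tw_one Tw_carrier)
next
  fix a b d assume abd: "a \<in> carrier Tw" "b \<in> carrier Tw" "d \<in> carrier Tw"
  obtain x w y v s r where [simp]: "a = (x, w)" "b = (y, v)" "d = (s, r)" by fastforce
  have car: "x \<in> carrier G" "w \<in> carrier G" "y \<in> carrier G" "v \<in> carrier G" "s \<in> carrier G" "r \<in> carrier G"
    using abd W_carrier by (auto simp: Tw_carrier)
  have "[B x y + B (x \<otimes> y) s = B x y + (B x s + B y s)] (mod int p)"
    by (rule cong_add[OF cong_refl B_mult_left]) (use car in auto)
  also have "B x y + (B x s + B y s) = B y s + (B x y + B x s)" by simp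
  also have "[B y s + (B x y + B x s) = B y s + B x (y \<otimes> s)] (mod int p)"
    by (rule cong_add[OF cong_refl cong_sym[OF B_mult_right]]) (use car in auto)
  finally have eq: "z [^] (B x y + B (x \<otimes> y) s) = z [^] (B y s + B x (y \<otimes> s))"
    by (simp only: z_pow_eq_iff)
  have "w \<otimes> v \<otimes> z [^] B x y \<otimes> r \<otimes> z [^] B (x \<otimes> y) s = w \<otimes> v \<otimes> r \<otimes> z [^] (B x y + B (x \<otimes> y) s)"
    using car z_pow_commute[of r "B x y"] by (simp add: m_assoc int_pow_mult z_pow_commute_assoc)
  also have "\<dots> = w \<otimes> (v \<otimes> r \<otimes> z [^] B y s) \<otimes> z [^] B x (y \<otimes> s)"
    unfolding eq using car by (simp add: m_assoc int_pow_mult)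
  finally show "a \<otimes>\<^bsub>Tw\<^esub> b \<otimes>\<^bsub>Tw\<^esub> d = a \<otimes>\<^bsub>Tw\<^esub> (b \<otimes>\<^bsub>Tw\<^esub> d)"
    using car by (simp add: Tw_mult m_assoc)
next
  fix a assume a: "a \<in> carrier Tw"
  obtain x w where [simp]: "a = (x, w)" by fastforce
  have xw: "x \<in> carrier G" "w \<in> W" "twists w (B x)" using a by (auto simp: Tw_carrier)
  show "\<one>\<^bsub>Tw\<^esub> \<otimes>\<^bsub>Tw\<^esub> a = a"
    using xw W_carrier z_pow_B_F(1)[OF one_F xw(1)] by (simp add: Tw_one Tw_mult)
  \<comment> \<open>The extra power of \<open>z\<close> cancels the cocycle value at
    \<open>inv x\<close> and \<open>x\<close>.\<close>
  let ?b = "(inv x, inv w \<otimes> z [^] (- B (inv x) x))"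
  have "twists (inv w) (B (inv x))"
    by (rule twists_cong[OF twists_inv[OF xw(3)]])
      (use hom_mod_inv[OF B_left xw(1)] cong_sym in blast)
  then have "twists (inv w \<otimes> z [^] (- B (inv x) x)) (B (inv x))" by (rule twists_mult_z_pow)
  then have b: "?b \<in> carrier Tw"
    using xw z_pow_W by (simp add: Tw_carrier subgroup.m_closed subgroup.m_inv_closed subgroup_W)
  have "inv w \<otimes> z [^] (- B (inv x) x) \<otimes> w \<otimes> z [^] B (inv x) x
      = z [^] (- B (inv x) x) \<otimes> z [^] B (inv x) x"
    using xw(2) W_carrier z_pow_commute[of w "- B (inv x) x"] by (simp add: m_assoc)
  also have "\<dots> = \<one>" by (simp add: int_pow_mult[symmetric])
  finally have "?b \<otimes>\<^bsub>Tw\<^esub> a = \<one>\<^bsub>Tw\<^esub>" using xw by (simp add: Tw_mult Tw_one)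
  then show "\<exists>b \<in> carrier Tw. b \<otimes>\<^bsub>Tw\<^esub> a = \<one>\<^bsub>Tw\<^esub>" using b by blast
qed

sublocale pair: group Tw by (rule group_Tw)

text \<open>Multiplying the \<open>j\<close>-th power by one more factor adds
  \<open>B (x [^] j) x\<close>, that is \<open>j * B x x\<close> modulo \<open>p\<close>, to the
  exponent of \<open>z\<close>; the sum over \<open>j < n\<close> gives the binomial
  coefficient.\<close>

lemma Tw_nat_pow:
  assumes "(x, w) \<in> carrier Tw"
  shows "(x, w) [^]\<^bsub>Tw\<^esub> (n::nat) = (x [^] n, w [^] n \<otimes> z [^] (int (n choose 2) * B x x))"
proof (induction n)
  case 0
  show ?case by (simp add: Tw_one numeral_2_eq_2)
next
  case (Suc n)
  have xw: "x \<in> carrier G" "w \<in> carrier G" using assms W_carrier by (auto simp: Tw_carrier)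
  let ?m = "int (n choose 2) * B x x"
  have "[?m + B (x [^] n) x = ?m + int n * B x x] (mod int p)"
    by (rule cong_add[OF cong_refl hom_mod_nat_pow[OF B_left[OF xw(1)] xw(1)]])
  also have "?m + int n * B x x = int (Suc n choose 2) * B x x"
    by (simp add: numeral_2_eq_2 algebra_simps)
  finally have eq: "z [^] (?m + B (x [^] n) x) = z [^] (int (Suc n choose 2) * B x x)"
    by (simp only: z_pow_eq_iff)
  have "w [^] n \<otimes> z [^] ?m \<otimes> w \<otimes> z [^] B (x [^] n) x = w [^] n \<otimes> w \<otimes> z [^] (?m + B (x [^] n) x)"
    using xw z_pow_commute[of w ?m] by (simp add: m_assoc int_pow_mult z_pow_commute_assoc)
  then show ?case using Suc xw by (simp add: Tw_mult eq)
qed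

text \<open>Oddness of \<open>p\<close> makes the cocycle term in \<open>p\<close>-th powers
  disappear.\<close>

lemma p_dvd_choose_two: "p dvd (p choose 2)"
proof -
  obtain m where m: "p = 2 * m + 1" using p_odd by (rule oddE)
  have "p choose 2 = p * m" by (simp add: choose_two m)
  then show ?thesis by simp
qed

text \<open>These pairs form the kernel of the projection of \<open>Tw\<close> to \<open>G\<close>,
  a copy of the group generated by \<open>z\<close>; multiplying by them moves within a
  fibre.\<close>

lemma one_z_pow:
  "(\<one>, z [^] (k::int)) \<in> carrier Tw"
  "(\<one>, z) [^]\<^bsub>Tw\<^esub> k = (\<one>, z [^] k)"
  "(g, w) \<in> carrier Tw \<Longrightarrow> (g, w) \<otimes>\<^bsub>Tw\<^esub> (\<one>, z [^] k) = (g, w \<otimes> z [^] k)"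
proof -
  have B1: "z [^] B \<one> \<one> = \<one>" by (rule z_pow_B_F(1)[OF one_F one_closed])
  have car: "(\<one>, z [^] k) \<in> carrier Tw" for k :: int
    using twists_mult_z_pow[of \<one> "B \<one>" k] pair.one_closed z_pow_W by (simp add: Tw_one Tw_carrier)
  then show "(\<one>, z [^] k) \<in> carrier Tw" .
  have "(\<one>, z) \<in> carrier Tw" using car[of 1] by simp
  then have nat: "(\<one>, z) [^]\<^bsub>Tw\<^esub> n = (\<one>, z [^] n)" for n :: nat
  proof (induction n)
    case 0
    then show ?case by (simp add: Tw_one)
  next
    case (Suc n)
    then show ?case by (simp add: Tw_mult B1)
  qed
  show "(\<one>, z) [^]\<^bsub>Tw\<^esub> k = (\<one>, z [^] k)"
  proof (cases k)
    case (nonneg n)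
    then show ?thesis using nat[of n] by (simp only: int_pow_int)
  next
    case (neg n)
    have "(\<one>, z [^] k) \<otimes>\<^bsub>Tw\<^esub> (\<one>, z [^] Suc n) = \<one>\<^bsub>Tw\<^esub>"
      unfolding neg int_pow_neg_int[OF z_carrier] by (simp add: Tw_mult Tw_one B1)
    moreover have "(\<one>, z [^] Suc n) \<in> carrier Tw" using car[of "int (Suc n)"] by (simp only: int_pow_int)
    ultimately have "inv\<^bsub>Tw\<^esub> (\<one>, z [^] Suc n) = (\<one>, z [^] k)"
      using car by (intro pair.inv_equality) auto
    then show ?thesis
      using pair.int_pow_neg_int[of "(\<one>, z)" "Suc n"] nat[of "Suc n"] car[of 1] neg by simp
  qed
  show "(g, w) \<otimes>\<^bsub>Tw\<^esub> (\<one>, z [^] k) = (g, w \<otimes> z [^] k)" if "(g, w) \<in> carrier Tw"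
    using that z_pow_B_F(2)[OF one_F, of g] W_carrier[of w] by (simp add: Tw_mult Tw_carrier)
qed

definition K :: "('a \<times> 'a) set" where "K = {(u, z [^] \<mu> u) | u. u \<in> F}"

lemma K_mult:
  assumes "u \<in> F" "(y, v) \<in> carrier Tw"
  shows "(u, z [^] \<mu> u) \<otimes>\<^bsub>Tw\<^esub> (y, v) = (u \<otimes> y, z [^] \<mu> u \<otimes> v)"
  using assms W_carrier[of v] by (simp add: Tw_mult Tw_carrier z_pow_B_F(1))

lemma K_carrier: "u \<in> F \<Longrightarrow> (u, z [^] \<mu> u) \<in> carrier Tw"
proof -
  assume u: "u \<in> F"
  have "twists (z [^] \<mu> u) (\<lambda>_. 0)" using z_pow_Z by (simp only: twists_Z_iff)
  then have "twists (z [^] \<mu> u) (B u)" by (rule twists_cong) (use B_F_left u cong_sym in blast)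
  then show ?thesis using u F_carrier z_pow_W by (simp add: Tw_carrier)
qed

lemma z_pow_\<mu>_mult: "u \<in> F \<Longrightarrow> v \<in> F \<Longrightarrow> z [^] \<mu> u \<otimes> z [^] \<mu> v = z [^] \<mu> (u \<otimes> v)"
  using hom_mod_FD[OF \<mu>, of u v] by (simp add: int_pow_mult[symmetric] z_pow_eq_iff cong_sym)

lemma z_pow_\<mu>_L: "u \<in> L \<Longrightarrow> z [^] \<mu> u = \<one>"
  using \<mu>_L by (simp add: z_pow_eq_one_iff)

lemma subgroup_K: "subgroup K Tw"
proof (rule pair.subgroupI)
  show "K \<subseteq> carrier Tw" using K_carrier by (auto simp: K_def)
  show "K \<noteq> {}" using one_F by (auto simp: K_def)
next
  fix a assume "a \<in> K"
  then obtain u where u: "u \<in> F" "a = (u, z [^] \<mu> u)" by (auto simp: K_def)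
  have iu: "inv u \<in> F" using u F by (simp add: subgroup.m_inv_closed)
  have "(inv u, z [^] \<mu> (inv u)) \<otimes>\<^bsub>Tw\<^esub> (u, z [^] \<mu> u) = \<one>\<^bsub>Tw\<^esub>"
    using K_mult[OF iu K_carrier[OF u(1)]] z_pow_\<mu>_mult[OF iu u(1)] F_carrier[OF u(1)]
      z_pow_\<mu>_L[OF subgroup.one_closed[OF L]] by (simp add: Tw_one)
  then have "inv\<^bsub>Tw\<^esub> a = (inv u, z [^] \<mu> (inv u))"
    unfolding u(2) using K_carrier u(1) iu by (intro pair.inv_equality) auto
  then show "inv\<^bsub>Tw\<^esub> a \<in> K" using iu by (auto simp: K_def)
next
  fix a b assume "a \<in> K" "b \<in> K"
  then obtain u v where uv: "u \<in> F" "a = (u, z [^] \<mu> u)" "v \<in> F" "b = (v, z [^] \<mu> v)"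
    by (auto simp: K_def)
  then have "a \<otimes>\<^bsub>Tw\<^esub> b = (u \<otimes> v, z [^] \<mu> (u \<otimes> v))"
    using K_mult[OF uv(1) K_carrier[OF uv(3)]] z_pow_\<mu>_mult by simp
  then show "a \<otimes>\<^bsub>Tw\<^esub> b \<in> K" using uv F by (auto simp: K_def subgroup.m_closed)
qed

text \<open>Exchanging two pairs changes the first coordinate by \<open>commutator G x y\<close> and
  the exponent of \<open>z\<close> by \<open>B x y - B y x\<close>, which is \<open>c x y\<close> by
  the choice of \<open>B\<close>. That is exactly the element of \<open>K\<close> over the
  commutator.\<close>

lemma K_commutator:
  assumes "a \<in> carrier Tw" "b \<in> carrier Tw"
  shows "\<exists>k \<in> K. a \<otimes>\<^bsub>Tw\<^esub> b = k \<otimes>\<^bsub>Tw\<^esub> (b \<otimes>\<^bsub>Tw\<^esub> a)"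
proof -
  obtain x w y v where ab: "a = (x, w)" "b = (y, v)" by fastforce
  have x: "x \<in> carrier G" "w \<in> W" and y: "y \<in> carrier G" "v \<in> W"
    using assms by (auto simp: ab Tw_carrier)
  let ?u = "commutator G x y"
  have u: "?u \<in> F" using comm_F x y by blast
  have "b \<otimes>\<^bsub>Tw\<^esub> a \<in> carrier Tw" using assms by blast
  then have "(?u, z [^] \<mu> ?u) \<otimes>\<^bsub>Tw\<^esub> (b \<otimes>\<^bsub>Tw\<^esub> a)
      = (?u \<otimes> (y \<otimes> x), z [^] c x y \<otimes> (v \<otimes> w \<otimes> z [^] B y x))"
    using K_mult[OF u] by (simp add: ab Tw_mult c_def)
  also have "z [^] c x y \<otimes> (v \<otimes> w \<otimes> z [^] B y x) = v \<otimes> w \<otimes> z [^] (c x y + B y x)"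
    using x y W_carrier by (simp add: m_assoc int_pow_mult z_pow_commute_assoc)
  also have "z [^] (c x y + B y x) = z [^] B x y"
    using B_swap[OF x(1) y(1)] by (simp add: z_pow_eq_iff cong_sym)
  also have "v \<otimes> w = w \<otimes> v" using x y by (simp add: W_mult_commute)
  also have "?u \<otimes> (y \<otimes> x) = x \<otimes> y" using mult_eq_commutator_mult[OF x(1) y(1)] by (rule sym)
  finally have "a \<otimes>\<^bsub>Tw\<^esub> b = (?u, z [^] \<mu> ?u) \<otimes>\<^bsub>Tw\<^esub> (b \<otimes>\<^bsub>Tw\<^esub> a)" by (simp add: ab Tw_mult)
  then show ?thesis using u by (auto simp: K_def)
qed

text \<open>Both \<open>w [^] p\<close> and the cocycle term are trivial, and \<open>x [^] p\<close>
  lies in \<open>L\<close>, where \<open>\<mu>\<close> vanishes; so the power is the element of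
  \<open>K\<close> over \<open>x [^] p\<close>.\<close>

lemma K_pow:
  assumes "a \<in> carrier Tw"
  shows "a [^]\<^bsub>Tw\<^esub> p \<in> K"
proof -
  obtain x w where a: "a = (x, w)" by fastforce
  have xw: "x \<in> carrier G" "w \<in> W" using assms by (auto simp: a Tw_carrier)
  have "z [^] (int (p choose 2) * B x x) = \<one>"
    using p_dvd_choose_two by (simp add: z_pow_eq_one_iff cong_0_iff)
  then have "a [^]\<^bsub>Tw\<^esub> p = (x [^] p, z [^] \<mu> (x [^] p))"
    using Tw_nat_pow[of x w p] assms W_pow[OF xw(2)] z_pow_\<mu>_L[OF pow_L[OF xw(1)]] by (simp add: a)
  then show ?thesis using L_F[OF pow_L[OF xw(1)]] by (auto simp: K_def)
qed

text \<open>Modulo \<open>K\<close> the group \<open>Tw\<close> is elementary abelian. A subgroup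
  above \<open>K\<close> that is maximal subject to avoiding \<open>(\<one>, z)\<close> is thus a
  complement of the kernel of the projection to \<open>G\<close>, hence the graph of a function. Its
  closure under products is the rule for \<open>\<delta> (x \<otimes> y)\<close>.\<close>

lemma derivation_exists:
  obtains \<delta> where "\<And>g. g \<in> carrier G \<Longrightarrow> \<delta> g \<in> W"
    "\<And>x y. x \<in> carrier G \<Longrightarrow> y \<in> carrier G \<Longrightarrow> \<delta> (x \<otimes> y) = \<delta> x \<otimes> \<delta> y \<otimes> z [^] B x y"
    "\<And>g. g \<in> carrier G \<Longrightarrow> twists (\<delta> g) (B g)"
    "\<And>u. u \<in> F \<Longrightarrow> \<delta> u = z [^] \<mu> u"
proof -
  have "carrier Tw \<subseteq> carrier G \<times> carrier G" using W_carrier by (auto simp: Tw_def)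
  then have fin': "finite (carrier Tw)" using fin finite_subset by blast
  have zX: "(\<one>, z) \<in> carrier Tw" using one_z_pow(1)[of 1] by simp
  \<comment> \<open>Over the identity \<open>K\<close> contains only the trivial pair, since
    \<open>\<mu>\<close> vanishes there modulo \<open>p\<close>.\<close>
  have zK: "(\<one>, z) \<notin> K"
  proof
    assume "(\<one>, z) \<in> K"
    then have "z = z [^] \<mu> \<one>" by (simp add: K_def)
    also have "\<dots> = \<one>" by (rule z_pow_\<mu>_L[OF subgroup.one_closed[OF L]])
    finally show False using z_neq by simp
  qed
  obtain M where M: "subgroup M Tw" "K \<subseteq> M" "(\<one>, z) \<notin> M"
    and cov: "\<And>y. y \<in> carrier Tw \<Longrightarrow> \<exists>k::int. y \<otimes>\<^bsub>Tw\<^esub> (\<one>, z) [^]\<^bsub>Tw\<^esub> k \<in> M"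
    using pair.maximal_avoiding[OF fin' p_prime subgroup_K K_commutator K_pow zX zK] by blast
  have MX: "a \<in> carrier Tw" if "a \<in> M" for a using subgroup.mem_carrier[OF M(1) that] .
  \<comment> \<open>The projection is onto because each \<open>B g\<close> vanishes on
    \<open>E\<close> and so is induced from \<open>W\<close>; by \<open>cov\<close>,
    \<open>M\<close> meets every coset of the kernel.\<close>
  have ex: "\<exists>w. (g, w) \<in> M" if g: "g \<in> carrier G" for g
  proof -
    obtain w where w: "w \<in> W" "twists w (B g)" using realise_in_W[OF B_right[OF g] B_E[OF g]] .
    then have gw: "(g, w) \<in> carrier Tw" using g by (simp add: Tw_carrier)
    obtain k :: int where "(g, w) \<otimes>\<^bsub>Tw\<^esub> (\<one>, z) [^]\<^bsub>Tw\<^esub> k \<in> M" using cov[OF gw] by blast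
    then have "(g, w \<otimes> z [^] k) \<in> M" by (simp only: one_z_pow(2) one_z_pow(3)[OF gw])
    then show ?thesis by blast
  qed
  \<comment> \<open>A kernel element in \<open>M\<close> whose exponent is prime to \<open>p\<close>
    would bring \<open>(\<one>, z)\<close> into \<open>M\<close>.\<close>
  have M_z: "z [^] k = \<one>" if k: "(\<one>, z [^] k) \<in> M" for k :: int
  proof (rule ccontr)
    assume "z [^] k \<noteq> \<one>"
    then have "\<not> int p dvd k" by (simp add: z_pow_eq_one_iff cong_0_iff)
    then obtain l where l: "[k * l = 1] (mod int p)" by (rule cong_inverse_prime[OF p_prime])
    have "(\<one>, z) [^]\<^bsub>Tw\<^esub> k \<in> M" using k by (simp only: one_z_pow(2))
    then have "((\<one>, z) [^]\<^bsub>Tw\<^esub> k) [^]\<^bsub>Tw\<^esub> l \<in> M"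
      using M(1) by (rule pair.subgroup_int_pow_closed[rotated])
    then have "(\<one>, z) [^]\<^bsub>Tw\<^esub> (k * l) \<in> M" by (simp only: pair.int_pow_pow[OF zX])
    then have "(\<one>, z [^] (k * l)) \<in> M" by (simp only: one_z_pow(2))
    moreover have "z [^] (k * l) = z [^] (1::int)" using l by (simp only: z_pow_eq_iff)
    ultimately show False using M(3) by simp
  qed
  \<comment> \<open>Two values over \<open>g\<close> induce the same functional, so they differ by a
    power of \<open>z\<close>. The corresponding kernel element is a quotient of elements of
    \<open>M\<close>, hence trivial.\<close>
  have uniq: "w = w'" if ww: "(g, w) \<in> M" "(g, w') \<in> M" for g w w'
  proof -
    have g: "g \<in> carrier G" "w \<in> W" "twists w (B g)" "w' \<in> W" "twists w' (B g)"
      using MX[OF ww(1)] MX[OF ww(2)] by (auto simp: Tw_carrier)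
    have "twists (inv w \<otimes> w') (\<lambda>_. 0)"
      by (rule twists_cong[OF twists_mult[OF twists_inv[OF g(3)] g(5)]]) simp
    moreover have "inv w \<otimes> w' \<in> W" using g by (simp add: subgroup.m_closed subgroup.m_inv_closed subgroup_W)
    ultimately obtain k :: int where k: "inv w \<otimes> w' = z [^] k" using W_Z by (auto simp: twists_Z_iff)
    have w': "w' = w \<otimes> z [^] k" unfolding k[symmetric] using g W_carrier by simp
    have "inv\<^bsub>Tw\<^esub> (g, w) \<otimes>\<^bsub>Tw\<^esub> (g, w') \<in> M" using ww M(1) by (simp add: subgroup.m_closed subgroup.m_inv_closed)
    moreover have "(g, w') = (g, w) \<otimes>\<^bsub>Tw\<^esub> (\<one>, z [^] k)" using one_z_pow(3)[OF MX[OF ww(1)]] w' by simp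
    ultimately have "(\<one>, z [^] k) \<in> M" using MX[OF ww(1)] one_z_pow(1) by simp
    then show ?thesis using w' M_z g W_carrier by simp
  qed
  define \<delta> where "\<delta> g = (SOME w. (g, w) \<in> M)" for g
  have \<delta>: "(g, \<delta> g) \<in> M" if "g \<in> carrier G" for g
    using someI_ex[OF ex[OF that]] by (simp add: \<delta>_def)
  show ?thesis
  proof
    show "\<delta> g \<in> W" "twists (\<delta> g) (B g)" if "g \<in> carrier G" for g
      using MX[OF \<delta>[OF that]] by (auto simp: Tw_carrier)
    show "\<delta> (x \<otimes> y) = \<delta> x \<otimes> \<delta> y \<otimes> z [^] B x y" if "x \<in> carrier G" "y \<in> carrier G" for x y
    proof (rule uniq[OF \<delta>])
      show "(x \<otimes> y, \<delta> x \<otimes> \<delta> y \<otimes> z [^] B x y) \<in> M"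
        using subgroup.m_closed[OF M(1) \<delta>[OF that(1)] \<delta>[OF that(2)]] by (simp add: Tw_mult)
    qed (use that in simp)
    show "\<delta> u = z [^] \<mu> u" if "u \<in> F" for u
      by (rule uniq[OF \<delta>[OF F_carrier[OF that]]]) (use that M(2) in \<open>auto simp: K_def\<close>)
  qed
qed

text \<open>In \<open>g \<otimes> \<delta> g\<close>, moving \<open>\<delta> x\<close> past
  \<open>y\<close> produces \<open>z [^] B x y\<close>, which is the cocycle term of
  \<open>\<delta>\<close>; this gives multiplicativity. For the order, the values of
  \<open>\<delta>\<close> lie in \<open>W\<close> and so in \<open>F\<close>, where
  \<open>\<phi>\<close> is explicit.\<close>

lemma automorphism_exists:
  obtains \<phi> where "\<phi> \<in> iso G G" "\<And>x. x \<in> carrier G \<Longrightarrow> (\<phi> ^^ p) x = x"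
    "\<And>u. u \<in> F \<Longrightarrow> \<phi> u = u \<otimes> z [^] \<mu> u"
proof -
  obtain \<delta> where \<delta>W: "\<And>g. g \<in> carrier G \<Longrightarrow> \<delta> g \<in> W"
    and \<delta>_mult: "\<And>x y. x \<in> carrier G \<Longrightarrow> y \<in> carrier G \<Longrightarrow> \<delta> (x \<otimes> y) = \<delta> x \<otimes> \<delta> y \<otimes> z [^] B x y"
    and tw: "\<And>g. g \<in> carrier G \<Longrightarrow> twists (\<delta> g) (B g)"
    and \<delta>F: "\<And>u. u \<in> F \<Longrightarrow> \<delta> u = z [^] \<mu> u"
    by (rule derivation_exists) blast
  define \<phi> where "\<phi> g = g \<otimes> \<delta> g" for g
  have \<delta>c: "\<delta> g \<in> carrier G" if "g \<in> carrier G" for g using \<delta>W[OF that] by (rule W_carrier)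
  have closed: "\<phi> g \<in> carrier G" if "g \<in> carrier G" for g using \<delta>c that by (simp add: \<phi>_def)
  have mult: "\<phi> (x \<otimes> y) = \<phi> x \<otimes> \<phi> y" if xy: "x \<in> carrier G" "y \<in> carrier G" for x y
  proof -
    have "\<phi> x \<otimes> \<phi> y = x \<otimes> (\<delta> x \<otimes> y) \<otimes> \<delta> y" using xy \<delta>c by (simp add: \<phi>_def m_assoc)
    also have "\<dots> = x \<otimes> (y \<otimes> \<delta> x \<otimes> z [^] B x y) \<otimes> \<delta> y" using twistsD[OF tw[OF xy(1)] xy(2)] by simp
    also have "\<dots> = \<phi> (x \<otimes> y)"
      using xy \<delta>c z_pow_commute[of "\<delta> y" "B x y"] \<delta>_mult[OF xy] by (simp add: \<phi>_def m_assoc)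
    finally show ?thesis by simp
  qed
  have \<phi>F: "\<phi> u = u \<otimes> z [^] \<mu> u" if "u \<in> F" for u using \<delta>F[OF that] by (simp add: \<phi>_def)
  have WF: "w \<in> F" if "w \<in> W" for w using W_N[OF that] NF by blast
  \<comment> \<open>\<open>\<phi>\<close> multiplies \<open>\<delta> g [^] j\<close> by
    \<open>z [^] (j * \<mu> (\<delta> g))\<close>; these exponents, summed over
    \<open>j < n\<close>, give the binomial coefficient, which \<open>p\<close> divides when
    \<open>n = p\<close>.\<close>
  have iter: "(\<phi> ^^ n) g = g \<otimes> (\<delta> g [^] n \<otimes> z [^] (int (n choose 2) * \<mu> (\<delta> g)))"
    if g: "g \<in> carrier G" for g n
  proof (induction n)
    case 0
    show ?case using g by (simp add: numeral_2_eq_2)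
  next
    case (Suc n)
    let ?m = "int (n choose 2) * \<mu> (\<delta> g)"
    have dF: "\<delta> g \<in> F" using WF \<delta>W g by blast
    have dn: "\<delta> g [^] n \<in> F" using WF \<delta>W[OF g] subgroup_int_pow_closed[OF subgroup_W, of "\<delta> g" "int n"]
      by (simp only: int_pow_int)
    have zF: "z [^] ?m \<in> F" using L_F z_pow_L by blast
    have "[\<mu> (\<delta> g [^] n) = int n * \<mu> (\<delta> g)] (mod int p)"
      using group.hom_mod_nat_pow[OF subgroup_imp_group[OF F] \<mu>, of "\<delta> g" n] dF
        nat_pow_consistent[of "\<delta> g" n F] by simp
    then have zn: "z [^] \<mu> (\<delta> g [^] n) = z [^] (int n * \<mu> (\<delta> g))" by (simp only: z_pow_eq_iff)
    have "(\<phi> ^^ Suc n) g = \<phi> (g \<otimes> (\<delta> g [^] n \<otimes> z [^] ?m))" using Suc by simp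
    also have "\<dots> = \<phi> g \<otimes> (\<phi> (\<delta> g [^] n) \<otimes> \<phi> (z [^] ?m))"
      using mult g \<delta>c by simp
    also have "\<phi> (z [^] ?m) = z [^] ?m" using \<phi>F[OF zF] z_pow_\<mu>_L[OF z_pow_L] by simp
    also have "\<phi> (\<delta> g [^] n) = \<delta> g [^] n \<otimes> z [^] (int n * \<mu> (\<delta> g))" using \<phi>F[OF dn] zn by simp
    also have "\<phi> g \<otimes> (\<delta> g [^] n \<otimes> z [^] (int n * \<mu> (\<delta> g)) \<otimes> z [^] ?m)
        = g \<otimes> (\<delta> g \<otimes> \<delta> g [^] n \<otimes> z [^] (int n * \<mu> (\<delta> g) + ?m))"
      using g \<delta>c by (simp add: \<phi>_def m_assoc int_pow_mult)
    also have "int n * \<mu> (\<delta> g) + ?m = int (Suc n choose 2) * \<mu> (\<delta> g)"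
      by (simp add: numeral_2_eq_2 algebra_simps)
    also have "\<delta> g \<otimes> \<delta> g [^] n = \<delta> g [^] Suc n" using \<delta>c[OF g] by (metis nat_pow_Suc2)
    finally show ?case .
  qed
  have order: "(\<phi> ^^ p) g = g" if g: "g \<in> carrier G" for g
  proof -
    have "z [^] (int (p choose 2) * \<mu> (\<delta> g)) = \<one>"
      using p_dvd_choose_two by (simp add: z_pow_eq_one_iff cong_0_iff)
    then show ?thesis using iter[OF g, of p] W_pow[OF \<delta>W[OF g]] g by simp
  qed
  have pow_closed: "(\<phi> ^^ n) g \<in> carrier G" if "g \<in> carrier G" for g n
    using iter[OF that] \<delta>c that by simp
  have "bij_betw \<phi> (carrier G) (carrier G)"
  \<comment> \<open>As \<open>\<phi> ^^ p\<close> is the identity on the carrier, the iterate one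
    short of it is the inverse.\<close>
  proof (rule bij_betw_byWitness[where f' = "\<phi> ^^ (p - 1)"])
    have p: "Suc (p - 1) = p" using p_gt_0 by simp
    show "\<forall>g \<in> carrier G. (\<phi> ^^ (p - 1)) (\<phi> g) = g"
      using order p by (metis comp_apply funpow_Suc_right)
    show "\<forall>g \<in> carrier G. \<phi> ((\<phi> ^^ (p - 1)) g) = g"
      using order p by (metis comp_apply funpow.simps(2))
  qed (use closed pow_closed in auto)
  then have "\<phi> \<in> iso G G" using closed mult by (auto simp: iso_def hom_def)
  then show ?thesis using that order \<phi>F by blast
qed

end

context frattini_step
begin

theorem automorphism_of_order_p:
  obtains \<phi> x where "\<phi> \<in> iso G G" "\<And>g. g \<in> carrier G \<Longrightarrow> (\<phi> ^^ p) g = g"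
    "\<And>u. u \<in> L \<Longrightarrow> \<phi> u = u" "x \<in> N" "\<phi> x \<noteq> x"
proof -
  obtain \<mu> x where \<mu>: "hom_mod (G\<lparr>carrier := F\<rparr>) p \<mu>" "\<And>u. u \<in> L \<Longrightarrow> [\<mu> u = 0] (mod int p)"
    and x: "x \<in> N" "[\<mu> x = 1] (mod int p)"
    by (rule functional) blast
  interpret frattini_step_functional G p z F N L \<mu>
    using \<mu> by unfold_locales
  obtain B where B: "\<And>x. x \<in> carrier G \<Longrightarrow> hom_mod G p (B x)"
    "\<And>y. y \<in> carrier G \<Longrightarrow> hom_mod G p (\<lambda>x. B x y)"
    "\<And>x y. x \<in> carrier G \<Longrightarrow> y \<in> carrier G \<Longrightarrow> [B x y = c x y + B y x] (mod int p)"
    "\<And>x y. x \<in> carrier G \<Longrightarrow> y \<in> E \<Longrightarrow> [B x y = 0] (mod int p)"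
    by (rule bilinear_form) blast
  interpret frattini_step_form G p z F N L \<mu> B
    using B by unfold_locales
  obtain \<phi> where \<phi>: "\<phi> \<in> iso G G" "\<And>x. x \<in> carrier G \<Longrightarrow> (\<phi> ^^ p) x = x"
    "\<And>u. u \<in> F \<Longrightarrow> \<phi> u = u \<otimes> z [^] \<mu> u"
    by (rule automorphism_exists) blast
  have "\<phi> u = u" if "u \<in> L" for u
    using \<phi>(3)[OF L_F[OF that]] z_pow_\<mu>_L[OF that] F_carrier[OF L_F[OF that]] by simp
  moreover have "\<phi> x \<noteq> x"
  proof -
    \<comment> \<open>\<open>\<mu>\<close> is normalised at \<open>x\<close>, so
      \<open>\<phi>\<close> multiplies \<open>x\<close> by \<open>z\<close>.\<close>
    have "z [^] \<mu> x = z [^] (1::int)" using x(2) by (simp only: z_pow_eq_iff)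
    then have "\<phi> x = x \<otimes> z" using \<phi>(3) x(1) NF by auto
    then show ?thesis using N_carrier[OF x(1)] z_neq by simp
  qed
  ultimately show ?thesis using that \<phi>(1,2) x(1) by blast
qed

end

section \<open>Frattini subgroups and centers of p-groups\<close>

context group
begin

text \<open>The kernel of a nonzero functional has prime index, so it is a maximal subgroup and
  contains the Frattini subgroup.\<close>

lemma hom_mod_frattini:
  assumes p: "Factorial_Ring.prime (p::nat)" and f: "hom_mod G p f" and u: "u \<in> frattini G"
  shows "[f u = 0] (mod int p)"
proof -
  define M where "M = {x \<in> carrier G. [f x = 0] (mod int p)}"
  have sM: "subgroup M G" unfolding M_def by (rule hom_mod_kernel[OF f])
  show ?thesis
  proof (cases "M = carrier G")
    case True
    then show ?thesis using u by (auto simp: frattini_def M_def)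
  next
    case False
    have "H = M \<or> H = carrier G" if H: "subgroup H G" "M \<subseteq> H" for H
    proof (rule disjCI)
      assume "H \<noteq> carrier G"
      show "H = M"
      proof (rule ccontr)
        assume "H \<noteq> M"
        then obtain h where h: "h \<in> H" "h \<notin> M" using H(2) by blast
        have hc: "h \<in> carrier G" using subgroup.mem_carrier[OF H(1) h(1)] .
        then have "\<not> int p dvd f h" using h(2) by (simp add: M_def cong_0_iff)
        then obtain l where l: "[f h * l = 1] (mod int p)" by (rule cong_inverse_prime[OF p])
        have "g \<in> H" if g: "g \<in> carrier G" for g
        proof -
          \<comment> \<open>The power \<open>h [^] ?k\<close> subtracts the value of
            \<open>f\<close> at \<open>g\<close>, so the product lies in the kernel and hence in
            \<open>H\<close>.\<close>
          let ?k = "- (l * f g)"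
          have "[f (g \<otimes> h [^] ?k) = f g + f (h [^] ?k)] (mod int p)"
            using g hc by (intro hom_modD[OF f]) auto
          also have "[f g + f (h [^] ?k) = f g + ?k * f h] (mod int p)"
            by (rule cong_add[OF cong_refl hom_mod_int_pow[OF f hc]])
          also have "f g + ?k * f h = f g + (- f g) * (f h * l)" by (simp add: algebra_simps)
          also have "[f g + (- f g) * (f h * l) = f g + (- f g) * 1] (mod int p)"
            by (rule cong_add[OF cong_refl cong_mult[OF cong_refl l]])
          finally have "g \<otimes> h [^] ?k \<in> M" using g hc by (simp add: M_def)
          then have "g \<otimes> h [^] ?k \<in> H" using H(2) by blast
          moreover have "inv (h [^] ?k) \<in> H"
            using h(1) H(1) by (meson subgroup.m_inv_closed subgroup_int_pow_closed)
          ultimately have "g \<otimes> h [^] ?k \<otimes> inv (h [^] ?k) \<in> H" using H(1) by (rule subgroup.m_closed[rotated])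
          then show ?thesis using g hc by (simp add: m_assoc)
        qed
        then show False using \<open>H \<noteq> carrier G\<close> subgroup.subset[OF H(1)] by blast
      qed
    qed
    then have "maximal_subgroup G M" using sM False by (auto simp: maximal_subgroup_def)
    then show ?thesis using u by (auto simp: frattini_def M_def)
  qed
qed

text \<open>Suppose the commutator \<open>t\<close> of \<open>x\<close> and \<open>y\<close> lies
  outside \<open>M\<close>. Commutators with \<open>t\<close> lie in \<open>M\<close>, so
  \<open>t\<close> normalises \<open>M\<close>, and by maximality every element is an element of
  \<open>M\<close> times a power of \<open>t\<close>. The exponents add under products, so
  \<open>x \<otimes> y\<close> and \<open>y \<otimes> x\<close> differ by an element of
  \<open>M\<close>, a contradiction.\<close>

lemma commutator_in_maximal_subgroup:
  assumes M: "maximal_subgroup G M"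
    and cc: "\<And>x y w. x \<in> carrier G \<Longrightarrow> y \<in> carrier G \<Longrightarrow> w \<in> carrier G \<Longrightarrow>
      commutator G (commutator G x y) w \<in> M"
    and xy: "x \<in> carrier G" "y \<in> carrier G"
  shows "commutator G x y \<in> M"
proof (rule ccontr)
  assume not_in: "commutator G x y \<notin> M"
  have sM: "subgroup M G" and max: "\<And>H. subgroup H G \<Longrightarrow> M \<subseteq> H \<Longrightarrow> H = M \<or> H = carrier G"
    using M by (auto simp: maximal_subgroup_def)
  note Mc = subgroup.mem_carrier[OF sM]
  define t where "t = commutator G x y"
  have t: "t \<in> carrier G" using xy by (simp add: t_def)
  have nat: "s [^] (n::nat) \<otimes> m \<otimes> inv (s [^] n) \<in> M"
    if s: "s \<in> carrier G" "\<And>w. w \<in> carrier G \<Longrightarrow> commutator G s w \<in> M" and m: "m \<in> M" for s n m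
  proof (induction n)
    case 0
    then show ?case using m Mc by simp
  next
    case (Suc n)
    let ?m = "s [^] n \<otimes> m \<otimes> inv (s [^] n)"
    have "s [^] Suc n \<otimes> m \<otimes> inv (s [^] Suc n) = s \<otimes> ?m \<otimes> inv s"
      unfolding nat_pow_Suc2[OF s(1)] using s(1) Mc[OF m] by (simp add: inv_mult_group m_assoc)
    also have "\<dots> = commutator G s ?m \<otimes> ?m" using s(1) Mc[OF m] by (simp add: conj_eq_commutator_mult)
    also have "\<dots> \<in> M" using Suc s(2)[OF Mc[OF Suc]] sM by (simp add: subgroup.m_closed)
    finally show ?case .
  qed
  have norm: "t [^] (k::int) \<otimes> m \<otimes> inv (t [^] k) \<in> M" if m: "m \<in> M" for k m
  proof (cases k)
    case (nonneg n)
    then show ?thesis using nat[OF t _ m, of n] cc xy by (simp add: t_def int_pow_int)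
  next
    case (neg n)
    have "t [^] k = inv t [^] Suc n"
      unfolding neg using t by (simp only: int_pow_neg_int nat_pow_inv)
    \<comment> \<open>The inverse of \<open>t\<close> is the commutator of \<open>y\<close> and
      \<open>x\<close>, so \<open>cc\<close> covers negative powers too.\<close>
    moreover have "commutator G (inv t) w \<in> M" if "w \<in> carrier G" for w
      using cc[OF xy(2,1) that] by (simp only: t_def inv_commutator[OF xy])
    ultimately show ?thesis using nat[of "inv t" m "Suc n"] t m by simp
  qed
  let ?H = "{m \<otimes> t [^] (k::int) | m k. m \<in> M}"
  have H: "subgroup ?H G" "M \<subseteq> ?H" "t \<in> ?H" using subgroup_adjoin[OF sM t norm] by auto
  have "?H \<noteq> M" using H(3) not_in by (metis t_def)
  then have Hc: "?H = carrier G" using max[OF H(1,2)] by blast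
  have mult: "\<exists>m \<in> M. a \<otimes> b = m \<otimes> t [^] (k + l)"
    if "a = m1 \<otimes> t [^] k" "m1 \<in> M" "b = m2 \<otimes> t [^] l" "m2 \<in> M" for a b m1 m2 and k l :: int
  proof -
    have "a \<otimes> b = (m1 \<otimes> (t [^] k \<otimes> m2 \<otimes> inv (t [^] k))) \<otimes> t [^] (k + l)"
      using that t Mc by (simp add: int_pow_mult m_assoc)
    then show ?thesis using norm that sM by (meson subgroup.m_closed)
  qed
  obtain m k where mk: "x = m \<otimes> t [^] (k::int)" "m \<in> M" using Hc xy(1) by blast
  obtain n l where nl: "y = n \<otimes> t [^] (l::int)" "n \<in> M" using Hc xy(2) by blast
  obtain m1 where m1: "m1 \<in> M" "x \<otimes> y = m1 \<otimes> t [^] (k + l)" using mult[OF mk nl] by blast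
  obtain m2 where m2: "m2 \<in> M" "y \<otimes> x = m2 \<otimes> t [^] (k + l)" using mult[OF nl mk] by (metis add.commute)
  have "commutator G x y = (x \<otimes> y) \<otimes> inv (y \<otimes> x)" using xy by (simp add: commutator_def inv_mult_group m_assoc)
  also have "\<dots> = m1 \<otimes> inv m2" unfolding m1(2) m2(2) using m1(1) m2(1) Mc t by (simp add: inv_mult_group m_assoc)
  also have "\<dots> \<in> M" using m1 m2 sM by (simp add: subgroup.m_closed subgroup.m_inv_closed)
  finally show False using not_in by simp
qed

text \<open>The preimage \<open>D\<close> of the center of G/R contains all commutators by
  \<open>cc\<close> and all \<open>p\<close>-th powers by \<open>pow\<close>. An element outside
  \<open>D\<close> would be separated from it by a functional, but functionals vanish on the
  Frattini subgroup.\<close>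

lemma commutator_frattini:
  assumes fin: "finite (carrier G)" and p: "Factorial_Ring.prime (p::nat)" and R: "R \<lhd> G"
    and cc: "\<And>x y w. x \<in> carrier G \<Longrightarrow> y \<in> carrier G \<Longrightarrow> w \<in> carrier G \<Longrightarrow>
      commutator G (commutator G x y) w \<in> R"
    and pow: "\<And>x. x \<in> carrier G \<Longrightarrow> x [^] p \<in> R"
    and x: "x \<in> carrier G" and u: "u \<in> frattini G"
  shows "commutator G x u \<in> R"
proof (rule ccontr)
  assume not_in: "commutator G x u \<notin> R"
  have sR: "subgroup R G" using R by (rule normal_imp_subgroup)
  note Rc = subgroup.mem_carrier[OF sR]
  have conj: "g \<otimes> r \<otimes> inv g \<in> R" if "g \<in> carrier G" "r \<in> R" for g r
    using that R by (simp add: normal.inv_op_closed2)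
  define D where "D = {u \<in> carrier G. \<forall>x \<in> carrier G. commutator G x u \<in> R}"
  have D: "subgroup D G"
  proof (rule subgroupI)
    show "D \<noteq> {}" using subgroup.one_closed[OF sR] by (auto simp: D_def commutator_def intro!: exI[of _ \<one>])
  next
    fix a assume a: "a \<in> D"
    have "commutator G g (inv a) \<in> R" if g: "g \<in> carrier G" for g
    proof -
      have "commutator G g (inv a) = inv a \<otimes> inv (commutator G g a) \<otimes> inv (inv a)"
        using a g by (simp add: D_def commutator_def inv_mult_group m_assoc)
      moreover have "inv a \<otimes> inv (commutator G g a) \<otimes> inv (inv a) \<in> R"
        using a g by (intro conj subgroup.m_inv_closed[OF sR]) (auto simp: D_def)
      ultimately show ?thesis by (simp only:)
    qed
    then show "inv a \<in> D" using a by (simp add: D_def)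
  next
    fix a b assume ab: "a \<in> D" "b \<in> D"
    have "commutator G g (a \<otimes> b) \<in> R" if g: "g \<in> carrier G" for g
    proof -
      have "commutator G g (a \<otimes> b) = commutator G g a \<otimes> (a \<otimes> commutator G g b \<otimes> inv a)"
        using ab g by (simp add: D_def commutator_def inv_mult_group m_assoc)
      then show ?thesis using ab g conj sR by (simp add: D_def subgroup.m_closed)
    qed
    then show "a \<otimes> b \<in> D" using ab by (simp add: D_def)
  qed (auto simp: D_def)
  have comm: "\<exists>k \<in> D. a \<otimes> b = k \<otimes> (b \<otimes> a)" if ab: "a \<in> carrier G" "b \<in> carrier G" for a b
  proof (rule bexI)
    have "commutator G g (commutator G a b) \<in> R" if "g \<in> carrier G" for g
      using subgroup.m_inv_closed[OF sR cc[OF ab that]] that ab by (simp add: inv_commutator)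
    then show "commutator G a b \<in> D" using ab by (simp add: D_def)
  qed (rule mult_eq_commutator_mult[OF ab])
  have pow': "a [^] p \<in> D" if a: "a \<in> carrier G" for a
  proof -
    have "commutator G g (a [^] p) \<in> R" if g: "g \<in> carrier G" for g
      using conj[OF g pow[OF a]] subgroup.m_inv_closed[OF sR pow[OF a]] sR
      by (simp add: commutator_def subgroup.m_closed)
    then show ?thesis using a by (simp add: D_def)
  qed
  have uc: "u \<in> carrier G" using u by (simp add: frattini_def)
  have "u \<notin> D" using not_in x by (auto simp: D_def)
  then obtain f where f: "hom_mod G p f" "[f u = 1] (mod int p)"
    using hom_mod_separating[OF fin p D comm pow' uc] by blast
  have "[1 = (0::int)] (mod int p)" using f(2) hom_mod_frattini[OF p f(1) u] by (blast intro: cong_sym cong_trans)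
  then show False using p by (auto simp: cong_0_iff)
qed

text \<open>Class equation: if only the identity were central, every other conjugacy class would
  have size divisible by \<open>p\<close>, and the group order would be one modulo
  \<open>p\<close>.\<close>

lemma p_group_center_nontrivial:
  assumes p: "Factorial_Ring.prime (p::nat)" and fin: "finite (carrier G)" and card: "card (carrier G) = p ^ n"
    and nontriv: "carrier G \<noteq> {\<one>}"
  shows "\<exists>x \<in> center_of G (carrier G). x \<noteq> \<one>"
proof (rule ccontr)
  assume contra: "\<not> (\<exists>x \<in> center_of G (carrier G). x \<noteq> \<one>)"
  define \<phi> where "\<phi> = (\<lambda>g. \<lambda>h \<in> carrier G. g \<otimes> h \<otimes> inv g)"
  interpret act: group_action G "carrier G" \<phi>
    unfolding \<phi>_def by (rule action_by_conjugation)
  have orbit_one: "orbit G \<phi> \<one> = {\<one>}"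
    by (auto simp: orbit_def \<phi>_def intro!: exI[of _ \<one>])
  have "p dvd card orb" if orb: "orb \<in> orbits G (carrier G) \<phi> - {{\<one>}}" for orb
  proof -
    obtain x where x: "x \<in> carrier G" "orb = orbit G \<phi> x" using orb by (auto simp: orbits_def)
    then have "x \<noteq> \<one>" using orb orbit_one by auto
    then have "x \<notin> center_of G (carrier G)" using contra by blast
    then obtain g where g: "g \<in> carrier G" "x \<otimes> g \<noteq> g \<otimes> x" using x(1) by (auto simp: center_of_def)
    have "g \<otimes> x \<otimes> inv g \<noteq> x"
    proof
      assume "g \<otimes> x \<otimes> inv g = x"
      then have "x \<otimes> g = g \<otimes> x \<otimes> inv g \<otimes> g" by simp
      also have "\<dots> = g \<otimes> x" using g(1) x(1) by (simp add: m_assoc)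
      finally show False using g(2) by simp
    qed
    moreover have "x \<in> orb" using act.orbit_refl x by simp
    moreover have "g \<otimes> x \<otimes> inv g \<in> orb" using g(1) x by (auto simp: orbit_def \<phi>_def)
    ultimately have "card orb \<noteq> 1" by (metis card_1_singletonE singletonD)
    moreover have "card orb dvd p ^ n"
      using act.orbit_stabilizer_theorem[OF x(1)] card x(2) by (metis dvd_triv_left order_def)
    ultimately show ?thesis using p by (metis divides_primepow_nat dvd_power gr0I power_0)
  qed
  then have 1: "p dvd (\<Sum>orb \<in> orbits G (carrier G) \<phi> - {{\<one>}}. card orb)" by (rule dvd_sum)
  have "finite (orbits G (carrier G) \<phi>)" using fin by (simp add: orbits_def)
  moreover have "{\<one>} \<in> orbits G (carrier G) \<phi>" using orbit_one by (auto simp: orbits_def)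
  ultimately have "(\<Sum>orb \<in> orbits G (carrier G) \<phi>. card orb)
      = 1 + (\<Sum>orb \<in> orbits G (carrier G) \<phi> - {{\<one>}}. card orb)"
    by (simp add: sum.remove)
  moreover have "(\<Sum>orb \<in> orbits G (carrier G) \<phi>. card orb) = card (carrier G)"
    using act.disjoint_sum[OF fin, of "\<lambda>_. 1::nat"] by simp
  moreover have "p dvd card (carrier G)"
  proof -
    have "card (carrier G) \<noteq> 1" using nontriv by (metis card_1_singletonE one_closed singletonD)
    then have "n \<noteq> 0" using card by auto
    then show ?thesis using card by simp
  qed
  ultimately have "p dvd 1" using 1 by (metis dvd_add_left_iff)
  then show False using p by simp
qed

lemma exists_power_of_prime_order:
  assumes p: "Factorial_Ring.prime (p::nat)" and card: "card (carrier G) = p ^ n"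
    and x: "x \<in> carrier G" "x \<noteq> \<one>"
  obtains k :: nat where "(x [^] k) [^] p = \<one>" "x [^] k \<noteq> \<one>"
proof -
  have "ord x dvd p ^ n" using ord_dvd_group_order[OF x(1)] card by (simp add: order_def)
  then obtain m where m: "ord x = p ^ m" using p divides_primepow_nat by blast
  have "m \<noteq> 0"
  proof
    assume "m = 0"
    then show False using m x ord_eq_1 by auto
  qed
  then obtain j where j: "m = Suc j" by (cases m) auto
  \<comment> \<open>Since \<open>x\<close> has order \<open>p ^ Suc j\<close>, the exponent
    \<open>p ^ j\<close> leaves order \<open>p\<close>.\<close>
  have "(x [^] (p ^ j)) [^] p = \<one>"
    using x(1) m j pow_ord_eq_1[OF x(1)] by (simp add: nat_pow_pow mult.commute)
  moreover have "x [^] (p ^ j) \<noteq> \<one>"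
  proof
    assume "x [^] (p ^ j) = \<one>"
    then have "p ^ Suc j dvd p ^ j" using pow_eq_id x(1) m j by metis
    then show False using p prime_gt_1_nat[OF p] by (metis power_dvd_imp_le Suc_n_not_le_n)
  qed
  ultimately show ?thesis using that by blast
qed

text \<open>With \<open>p * q\<close> the order of \<open>c\<close>, the exponents of elements
  killed by \<open>p\<close> are multiples of \<open>q\<close>. Dividing by \<open>q\<close>, the
  exponent of \<open>z\<close> becomes invertible modulo \<open>p\<close> because \<open>z\<close>
  is nontrivial.\<close>

lemma cyclic_torsion:
  assumes p: "Factorial_Ring.prime (p::nat)" and c: "c \<in> carrier G"
    and z: "z = c [^] (m::int)" "z [^] p = \<one>" "z \<noteq> \<one>" and x: "x = c [^] (k::int)" "x [^] p = \<one>"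
  shows "\<exists>l::int. x = z [^] l"
proof -
  define o' where "o' = int (ord c)"
  have om: "o' dvd m * int p" and ok: "o' dvd k * int p" and nm: "\<not> o' dvd m"
    using z x c by (simp_all add: o'_def int_pow_eq_id int_pow_pow flip: int_pow_int)
  have "int p dvd o'"
  proof (rule ccontr)
    assume "\<not> int p dvd o'"
    then have "coprime (int p) o'" using p by (intro prime_imp_coprime) auto
    then show False using om nm by (metis coprime_commute coprime_dvd_mult_left_iff)
  qed
  then obtain q where q: "o' = int p * q" by blast
  have p0: "int p \<noteq> 0" using p by (auto dest: prime_gt_0_nat)
  have "q dvd m" using om p0 q by (simp add: mult.commute)
  then obtain m' where m': "m = q * m'" by (rule dvdE)
  have "q dvd k" using ok p0 q by (simp add: mult.commute)
  then obtain k' where k': "k = q * k'" by (rule dvdE)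
  have "\<not> int p dvd m'" using nm by (auto simp: q m' mult.commute)
  then obtain l where "[m' * l = 1] (mod int p)" by (rule cong_inverse_prime[OF p])
  then have "int p dvd 1 - m' * l" by (simp add: cong_iff_dvd_diff dvd_diff_commute)
  then have "o' dvd (q * k') * (1 - m' * l)" unfolding q by (simp add: mult_dvd_mono mult.commute)
  also have "(q * k') * (1 - m' * l) = k - m * (l * k')" by (simp add: m' k' algebra_simps)
  finally have "c [^] k = c [^] (m * (l * k'))"
    using int_pow_eq[OF c] by (simp add: o'_def dvd_diff_commute)
  then have "x = z [^] (l * k')" using c by (simp add: x(1) z(1) int_pow_pow)
  then show ?thesis by blast
qed

text \<open>As \<open>z\<close> is central and \<open>f\<close> vanishes on \<open>N\<close>, the
  map \<open>g \<mapsto> z [^] f g\<close> is an admissible derivation. Its automorphism is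
  conjugation by some \<open>h\<close>, which centralises \<open>N\<close> because \<open>f\<close>
  vanishes there, and so lies in \<open>N\<close> by \<open>self_centr\<close>.\<close>

lemma realise_by_inner:
  assumes N: "subgroup N G" and z: "z \<in> center_of G N" "z [^] p = \<one>"
    and zc: "\<And>g. g \<in> carrier G \<Longrightarrow> z \<otimes> g = g \<otimes> z"
    and f: "hom_mod G p f" and fN: "\<And>u. u \<in> N \<Longrightarrow> [f u = 0] (mod int p)"
    and self_centr: "centralizer G N \<subseteq> N"
    and der: "\<And>\<delta>. \<delta> \<in> derivations G N (Omega1 G p (center_of G N)) \<Longrightarrow>
          (\<lambda>g. g \<otimes> \<delta> g) \<in> iso G G \<Longrightarrow> inner_automorphism G (\<lambda>g. g \<otimes> \<delta> g)"
  shows "\<exists>h \<in> center_of G N. \<forall>g \<in> carrier G. h \<otimes> g = g \<otimes> h \<otimes> z [^] f g"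
proof -
  have zcar [simp]: "z \<in> carrier G" using z(1) subgroup.mem_carrier[OF N] by (auto simp: center_of_def)
  have z_Z: "z \<in> center_of G (carrier G)" using zc by (simp add: center_of_def)
  have zk: "z [^] (k::int) \<in> center_of G N" "z [^] k \<in> center_of G (carrier G)" for k
    using z(1) z_Z subgroup_center_of[OF N] subgroup_center_of[OF subgroup_self]
    by (simp_all add: subgroup_int_pow_closed)
  have zk_comm: "z [^] (k::int) \<otimes> g = g \<otimes> z [^] k" if "g \<in> carrier G" for g k
    using zk(2)[of k] that by (simp add: center_of_def)
  have zk_N: "z [^] (k::int) \<in> N" for k using zk(1)[of k] by (simp add: center_of_def)
  have zp: "z [^] (int p * k) = \<one>" for k
    using z(2) by (simp add: int_pow_pow[symmetric] int_pow_int)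
  have z_eq: "z [^] a = z [^] b" if ab: "[a = b] (mod int p)" for a b
  proof -
    obtain q where "b = a + int p * q" using ab by (metis cong_iff_lin)
    then show ?thesis by (simp add: int_pow_mult zp)
  qed
  have f_mult: "z [^] f (x \<otimes> y) = z [^] f x \<otimes> z [^] f y" if "x \<in> carrier G" "y \<in> carrier G" for x y
    using z_eq[OF hom_modD[OF f that]] by (simp add: int_pow_mult)
  have f_N: "z [^] f u = \<one>" if "u \<in> N" for u using z_eq[OF fN[OF that]] by simp
  let ?\<delta> = "\<lambda>g. z [^] f g" and ?\<phi> = "\<lambda>g. g \<otimes> z [^] f g"
  have "?\<delta> g \<in> Omega1 G p (center_of G N)" for g
  proof -
    have "(z [^] f g) [^] p = \<one>"
      using zp[of "f g"] by (simp add: int_pow_pow mult.commute flip: int_pow_int)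
    then show ?thesis using zk(1) by (auto simp: Omega1_def intro: generate.incl)
  qed
  moreover have "?\<delta> (x \<otimes> y) = (inv y \<otimes> ?\<delta> x \<otimes> y) \<otimes> ?\<delta> y" if "x \<in> carrier G" "y \<in> carrier G" for x y
    using f_mult[OF that] that zk_comm[of y "f x"] by (simp add: m_assoc)
  ultimately have "?\<delta> \<in> derivations G N (Omega1 G p (center_of G N))"
    using f_N by (simp add: derivations_def)
  moreover have "?\<phi> \<in> iso G G"
  proof -
    have "?\<phi> (x \<otimes> y) = ?\<phi> x \<otimes> ?\<phi> y" if "x \<in> carrier G" "y \<in> carrier G" for x y
    proof -
      have "?\<phi> x \<otimes> ?\<phi> y = x \<otimes> (z [^] f x \<otimes> y) \<otimes> z [^] f y" using that by (simp add: m_assoc)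
      also have "\<dots> = ?\<phi> (x \<otimes> y)" using that f_mult[OF that] zk_comm[of y "f x"] by (simp add: m_assoc)
      finally show ?thesis by simp
    qed
    moreover have "bij_betw ?\<phi> (carrier G) (carrier G)"
    \<comment> \<open>Powers of \<open>z\<close> lie in \<open>N\<close>, where \<open>f\<close>
      vanishes, so changing the sign of the exponent inverts the map.\<close>
    proof (rule bij_betw_byWitness[where f' = "\<lambda>g. g \<otimes> z [^] (- f g)"])
      have f_zk: "z [^] f (g \<otimes> z [^] (k::int)) = z [^] f g" if "g \<in> carrier G" for g k
        using f_mult[of g "z [^] k"] f_N[OF zk_N] that by simp
      show "\<forall>g \<in> carrier G. g \<otimes> z [^] f g \<otimes> z [^] (- f (g \<otimes> z [^] f g)) = g"
        using f_zk by (simp add: m_assoc int_pow_neg)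
      show "\<forall>g \<in> carrier G. g \<otimes> z [^] (- f g) \<otimes> z [^] f (g \<otimes> z [^] (- f g)) = g"
        by (simp add: f_zk m_assoc int_pow_mult[symmetric])
    qed auto
    ultimately show ?thesis by (auto simp: iso_def hom_def)
  qed
  ultimately have "inner_automorphism G ?\<phi>" by (rule der)
  then obtain h where h: "h \<in> carrier G" "\<And>g. g \<in> carrier G \<Longrightarrow> g \<otimes> z [^] f g = h \<otimes> g \<otimes> inv h"
    by (auto simp: inner_automorphism_def)
  have hg: "h \<otimes> g = g \<otimes> h \<otimes> z [^] f g" if g: "g \<in> carrier G" for g
  proof -
    have "h \<otimes> g = (h \<otimes> g \<otimes> inv h) \<otimes> h" using h(1) g by (simp add: m_assoc)
    also have "\<dots> = (g \<otimes> z [^] f g) \<otimes> h" using h(2)[OF g] by simp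
    also have "\<dots> = g \<otimes> h \<otimes> z [^] f g" using h(1) g zk_comm[of h "f g"] by (simp add: m_assoc)
    finally show ?thesis .
  qed
  have "h \<otimes> u = u \<otimes> h" if "u \<in> N" for u
    using hg[of u] f_N[OF that] subgroup.mem_carrier[OF N that] h(1) by simp
  then have "h \<in> centralizer G N" using h(1) by (simp add: centralizer_def)
  then have "h \<in> center_of G N" using self_centr by (auto simp: center_of_def centralizer_def)
  then show ?thesis using hg by blast
qed

end

text \<open>Since \<open>p\<close> is prime, order \<open>p\<close> is expressed by
  \<open>\<phi> ^^ p\<close> being the identity on the carrier while \<open>\<phi>\<close> is
  not.\<close>

theorem theorem4p2:
  fixes G :: "('a, 'b) monoid_scheme" and p T i :: nat and P :: "nat \<Rightarrow> 'a set"
  assumes p_prime: "Factorial_Ring.prime p" and p_odd: "odd p"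
    and pgrp: "p_group G p"
    and nonab: "\<not> comm_group G"
    and cyc: "cyclic_group (subgroup_generated G (center_of G (carrier G)))"
    and omega: "Omega1 G p (center_of G (carrier G))
                  \<subseteq> subgroup_prod G (gamma3 G) (power_subgroup G p)"
    and T_pos: "T \<ge> 1"
    and index: "card (frattini G)
                  = p ^ T * card (subgroup_prod G (gamma3 G) (power_subgroup G p))"
    and P_normal: "\<And>j. j \<le> T \<Longrightarrow> P j \<lhd> G"
    and P_0: "P 0 = frattini G"
    and P_T: "P T = subgroup_prod G (gamma3 G) (power_subgroup G p)"
    and P_chain: "\<And>j. j < T \<Longrightarrow> P (Suc j) \<subseteq> P j"
    and P_index: "\<And>j. j < T \<Longrightarrow> card (P j) = p * card (P (Suc j))"
    and i_lt: "i < T"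
    and self_centr: "centralizer G (P i) \<subseteq> P i"
    and der_inner: "\<And>\<delta>. \<delta> \<in> derivations G (P i) (Omega1 G p (center_of G (P i))) \<Longrightarrow>
          (\<lambda>g. g \<otimes>\<^bsub>G\<^esub> \<delta> g) \<in> iso G G \<Longrightarrow>
          inner_automorphism G (\<lambda>g. g \<otimes>\<^bsub>G\<^esub> \<delta> g)"
  shows "\<exists>\<phi> \<in> iso G G.
           (\<forall>x \<in> carrier G. (\<phi> ^^ p) x = x) \<and> (\<exists>x \<in> carrier G. \<phi> x \<noteq> x) \<and>
           (\<forall>x \<in> P (Suc i). \<phi> x = x) \<and> (\<exists>x \<in> P i. \<phi> x \<noteq> x)"
proof -
  obtain n where grp: "group G" and fin: "finite (carrier G)" and card: "card (carrier G) = p ^ n"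
    using pgrp by (auto simp: p_group_def)
  interpret group G by (rule grp)
  let ?Z = "center_of G (carrier G)"
  have sP: "subgroup (P j) G" if "j \<le> T" for j
    using P_normal[OF that] by (rule normal_imp_subgroup)
  have chain: "P k \<subseteq> P j" if "j \<le> k" "k \<le> T" for j k
    using that
  proof (induction k rule: dec_induct)
    case base
    show ?case by simp
  next
    case (step k)
    then show ?case using P_chain[of k] by auto
  qed
  have commutators: "commutator G x y \<in> commutator_subgroup G A C" if "x \<in> A" "y \<in> C" for x y A C
    unfolding commutator_subgroup_def commutator_def using that by (blast intro: generate.incl)
  have T_cc: "commutator G (commutator G x y) w \<in> P T"
    if "x \<in> carrier G" "y \<in> carrier G" "w \<in> carrier G" for x y w
    unfolding P_T subgroup_prod_def gamma3_def using that by (intro generate.incl UnI1 commutators)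
  have T_pow: "x [^]\<^bsub>G\<^esub> p \<in> P T" if "x \<in> carrier G" for x
    unfolding P_T subgroup_prod_def power_subgroup_def using that by (blast intro: generate.incl)
  have F_ker: "[f u = 0] (mod int p)" if "hom_mod G p f" "u \<in> P 0" for f u
    using hom_mod_frattini[OF p_prime] that P_0 by simp
  \<comment> \<open>\<open>P T\<close> lies in the Frattini subgroup, hence in every maximal
    subgroup, which therefore contains all triple commutators.\<close>
  have F_comm: "commutator G x y \<in> P 0" if "x \<in> carrier G" "y \<in> carrier G" for x y
  proof -
    have "commutator G x y \<in> M" if M: "maximal_subgroup G M" for M
    proof -
      have "P T \<subseteq> M" using chain[of 0 T] M by (auto simp: P_0 frattini_def)
      then show ?thesis
        using commutator_in_maximal_subgroup[OF M] T_cc \<open>x \<in> carrier G\<close> \<open>y \<in> carrier G\<close> by blast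
    qed
    then show ?thesis using that by (simp add: P_0 frattini_def)
  qed
  have T_comm: "commutator G x u \<in> P T" if "x \<in> carrier G" "u \<in> P 0" for x u
    using commutator_frattini[OF fin p_prime P_normal[of T] T_cc T_pow] that P_0 by simp
  have TL: "P T \<subseteq> P (Suc i)" using chain[of "Suc i" T] i_lt by simp
  have LN: "P (Suc i) \<subset> P i"
  proof -
    have "finite (P (Suc i))" using finite_subset[OF subgroup.subset[OF sP] fin] i_lt by simp
    moreover have "P (Suc i) \<noteq> {}" using subgroup.one_closed[OF sP[of "Suc i"]] i_lt by auto
    ultimately have "card (P (Suc i)) \<noteq> 0" by simp
    then have "card (P i) \<noteq> card (P (Suc i))"
      using P_index[OF i_lt] prime_gt_1_nat[OF p_prime] by auto
    then show ?thesis using P_chain[OF i_lt] by auto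
  qed
  have NF: "P i \<subseteq> P 0" using chain[of 0 i] i_lt by simp
  have N: "subgroup (P i) G" using sP i_lt by simp
  have sZ: "subgroup ?Z G" by (rule subgroup_center_of[OF subgroup_self])
  have Zc: "x \<in> carrier G" if "x \<in> ?Z" for x using that by (simp add: center_of_def)
  have Z_N: "?Z \<subseteq> P i"
    using self_centr subgroup.subset[OF N] by (auto simp: center_of_def centralizer_def)
  obtain c where c: "c \<in> ?Z" "\<And>x. x \<in> ?Z \<Longrightarrow> \<exists>k::int. x = c [^]\<^bsub>G\<^esub> k"
  proof -
    interpret Zg: group "subgroup_generated G ?Z" by (rule group_subgroup_generated)
    have car: "carrier (subgroup_generated G ?Z) = ?Z" by (rule subgroup.carrier_subgroup_generated_subgroup[OF sZ])
    obtain c where "c \<in> ?Z" "?Z = range (\<lambda>k::int. c [^]\<^bsub>subgroup_generated G ?Z\<^esub> k)"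
      using cyc unfolding Zg.cyclic_group car by blast
    moreover from this have "c [^]\<^bsub>subgroup_generated G ?Z\<^esub> (k::int) = c [^]\<^bsub>G\<^esub> k" for k
      using int_pow_subgroup_generated[of c ?Z k] car by simp
    ultimately show ?thesis using that by auto
  qed
  \<comment> \<open>A trivial group leaves no room for the strict inclusion
    \<open>LN\<close>.\<close>
  have "carrier G \<noteq> {\<one>\<^bsub>G\<^esub>}"
  proof
    assume triv: "carrier G = {\<one>\<^bsub>G\<^esub>}"
    then have "P i = {\<one>\<^bsub>G\<^esub>}" "P (Suc i) = {\<one>\<^bsub>G\<^esub>}"
      using subgroup.subset[OF N] subgroup.one_closed[OF N] sP[of "Suc i"] i_lt
        subgroup.subset[OF sP[of "Suc i"]] subgroup.one_closed[OF sP[of "Suc i"]] by auto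
    then show False using LN by simp
  qed
  then obtain y where y: "y \<in> ?Z" "y \<noteq> \<one>\<^bsub>G\<^esub>"
    using p_group_center_nontrivial[OF p_prime fin card] by blast
  obtain k :: nat where k: "(y [^]\<^bsub>G\<^esub> k) [^]\<^bsub>G\<^esub> p = \<one>\<^bsub>G\<^esub>" "y [^]\<^bsub>G\<^esub> k \<noteq> \<one>\<^bsub>G\<^esub>"
    using exists_power_of_prime_order[OF p_prime card Zc[OF y(1)] y(2)] .
  \<comment> \<open>An element of order \<open>p\<close> in the center; as the center is cyclic, its
    powers are all central elements of exponent \<open>p\<close>.\<close>
  define z where "z = y [^]\<^bsub>G\<^esub> k"
  have z: "z \<in> ?Z" "z [^]\<^bsub>G\<^esub> p = \<one>\<^bsub>G\<^esub>" "z \<noteq> \<one>\<^bsub>G\<^esub>"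
    using k subgroup_int_pow_closed[OF sZ y(1), of "int k"] by (simp_all add: z_def int_pow_int)
  \<comment> \<open>Here \<open>omega\<close> places \<open>z\<close> in \<open>P T\<close>, and so
    in the subgroup that \<open>\<phi>\<close> is to fix.\<close>
  have "z \<in> Omega1 G p ?Z" unfolding Omega1_def using z by (intro generate.incl) simp
  then have zL: "z \<in> P (Suc i)" using omega P_T TL by auto
  have torsion: "\<exists>l::int. x = z [^]\<^bsub>G\<^esub> l" if x: "x \<in> ?Z" "x [^]\<^bsub>G\<^esub> p = \<one>\<^bsub>G\<^esub>" for x
  proof -
    obtain m where m: "z = c [^]\<^bsub>G\<^esub> (m::int)" using c(2)[OF z(1)] by blast
    obtain j where j: "x = c [^]\<^bsub>G\<^esub> (j::int)" using c(2)[OF x(1)] by blast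
    show ?thesis using cyclic_torsion[OF p_prime Zc[OF c(1)] m z(2,3) j x(2)] .
  qed
  have realise: "\<exists>h \<in> center_of G (P i). \<forall>g \<in> carrier G. h \<otimes>\<^bsub>G\<^esub> g = g \<otimes>\<^bsub>G\<^esub> h \<otimes>\<^bsub>G\<^esub> z [^]\<^bsub>G\<^esub> f g"
    if f: "hom_mod G p f" for f
  proof (rule realise_by_inner[OF N _ z(2) _ f _ self_centr der_inner])
    show "z \<in> center_of G (P i)"
      using z(1) zL LN subgroup.subset[OF N] by (auto simp: center_of_def)
    show "z \<otimes>\<^bsub>G\<^esub> g = g \<otimes>\<^bsub>G\<^esub> z" if "g \<in> carrier G" for g using z(1) that by (simp add: center_of_def)
    show "[f u = 0] (mod int p)" if "u \<in> P i" for u using F_ker[OF f] NF that by blast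
  qed
  interpret frattini_step G p z "P 0" "P i" "P (Suc i)"
  proof (intro frattini_step.intro frattini_step_axioms.intro)
    show "\<exists>c \<in> ?Z. \<forall>x \<in> ?Z. \<exists>k::int. x = c [^]\<^bsub>G\<^esub> k" using c by blast
    show "x [^]\<^bsub>G\<^esub> p \<in> P (Suc i)" if "x \<in> carrier G" for x using T_pow[OF that] TL by blast
    show "commutator G x u \<in> P (Suc i)" if "x \<in> carrier G" "u \<in> P 0" for x u
      using T_comm[OF that] TL by blast
  qed (fact grp fin p_prime p_odd N LN NF zL z Z_N torsion F_comm F_ker realise | use sP i_lt in simp)+
  obtain \<phi> x where "\<phi> \<in> iso G G" "\<And>g. g \<in> carrier G \<Longrightarrow> (\<phi> ^^ p) g = g"
    "\<And>u. u \<in> P (Suc i) \<Longrightarrow> \<phi> u = u" "x \<in> P i" "\<phi> x \<noteq> x"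
    by (rule automorphism_of_order_p) blast
  moreover have "x \<in> carrier G" by (rule N_carrier) fact
  ultimately show ?thesis by blast
qed

end
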